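(* Suppose that an $N$-DM non-sequential stochastic control problem possesses Property C for all admissible policies $\gamma\in\Gamma$, and that the set $\mathbb{Y}^i$ is countable for each $i=1,\dots,N$. Then the problem admits a policy-independent static reduction, in which each DM's measurements are independent from the other DMs' policies/actions and are exogenous.
   Context: **Model.** A non-sequential stochastic control (team) problem with $N\in\mathbb{N}$ decision makers (DMs) consists of: a probability space $(\Omega,\mathcal{F},P)$; standard Borel action spaces $(\mathbb{U}^i,\mathcal{U}^i)$ and standard Borel measurement spaces $(\mathbb{Y}^i,\mathcal{Y}^i)$, $i=1,\dots,N$; measurable measurement functions $\eta^i:\Omega\times\prod_{k=1}^N\mathbb{U}^k\to\mathbb{Y}^i$, giving the measurement $y^i=\eta^i(\omega,\mathbf{u})$ of DM $i$, where $\mathbf{u}=(u^1,\dots,u^N)$. An admissible policy is $\gamma=(\gamma^1,\dots,\gamma^N)\in\Gamma$ with each $\gamma^i:\mathbb{Y}^i\to\mathbb{U}^i$ measurable, $u^i=\gamma^i(y^i)$. The exogenous randomness is refined into random variables $\omega_{s_0},\omega_0,\omega_1,\dots,\omega_N$ on $(\Omega,\mathcal{F})$: $\omega_0$ is cost-relevant, $\omega_{s_0}$ is the randomness relevant to the ordering of DMs, and $\omega_i$ is noise in $y^i$. The cost function is $c(\omega_0,\omega_{s_0},\mathbf{u})\ge 0$ and $J(\gamma)=E^\gamma[c(\omega_0,\omega_{s_0},\mathbf{u})]$. **Orderings.** For $k=1,\dots,N$, $S_k$ is the set of $k$-DM orderings $(s_1,\dots,s_k)$ (sequences of $k$ distinct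 elements of $\{1,\dots,N\}$); $s_j=i$ means that DM $i$ is the $j$-th to act. $T^N_k:S_N\to S_k$ is truncation to the first $k$ entries. An ordering map is a map $\psi:\Omega\times\prod_i\mathbb{U}^i\to S_N$ (depending on $\omega$ through $\omega_{s_0}$), $\psi(\omega,\mathbf{u})=(s_1,\dots,s_N)$. **Induced objects.** Given $\psi$, let $\bar y^k=\sum_{i}\eta^i(\omega,\mathbf{u})1_{\{s_k=i\}}$ (i.e. $\bar y^k=\eta^i(\omega,\mathbf{u})$ when $s_k=i$) and $\bar u^k=\sum_i u^i1_{\{s_k=i\}}$ (i.e. $\bar u^k=u^i$ when $s_k=i$), with values in $\bar{\mathbb{Y}}^k=\bigcup_i\mathbb{Y}^i$ and $\bar{\mathbb{U}}^k=\bigcup_i\mathbb{U}^i$, regarded as standard Borel spaces containing the $\mathbb{Y}^i$ (resp. $\mathbb{U}^i$) as measurable subspaces. $\bar{\mathscr{J}}^k$ is the smallest $\sigma$-algebra on $\Omega\times\prod_i\mathbb{U}^i$ making $\bar y^k$ measurable, and $\mathscr{F}^*(k)$ the smallest one making $(\omega,\bar u^1,\dots,\bar u^k)$ measurable. The $k$-th DM to act (the $k$-th "imaginary" DM) applies $\bar u^k=\bar\gamma^k(\bar y^k,s_k):=\gamma^{s_k}(\bar y^k)$. **Property C (Causality).** There exists an ordering map $\psi$ such that for all $k\in\{1,\dots,N\}$ and $s\in S_k$, $\{E\cap[T^N_k\circ\psi]^{-1}(s)\mid E\in\bar{\mathscr{J}}^k\}\subseteq\mathscr{F}^*(k-1)$.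 **Policy-independent static reduction.** The problem admits a policy-independent static reduction if it is equivalent to a static team problem obtained by changing the laws of the measurements to fixed probability measures and absorbing the change into the cost, with none of these objects depending on the policy: there exist probability measures $\hat Q_k$ on the measurement spaces of the variables $\hat y^k=(\bar y^k,s_k)\in\bar{\mathbb{Y}}^k\times\{1,\dots,N\}$, $k=1,\dots,N$, and a measurable cost function $\mathbf{c}(\omega_0,\omega_{s_0},\hat y^1,\dots,\hat y^N,\bar u^1,\dots,\bar u^N)$, all independent of $\gamma$, such that for every $\gamma\in\Gamma$ $$J(\gamma)=\int P(d\omega_0,d\omega_{s_0})\prod_{k=1}^N\hat Q_k(d\hat y^k)\,P^{\bar\gamma^k}(d\bar u^k\mid\hat y^k)\;\mathbf{c}(\omega_0,\omega_{s_0},\hat y^{[1,N]},\bar u^{[1,N]}),$$ where $P^{\bar\gamma^k}(\cdot\mid\hat y^k)$ is the law of the action $\bar\gamma^k(\bar y^k,s_k)=\gamma^{s_k}(\bar y^k)$ (extended arbitrarily and measurably when $\bar y^k\notin\mathbb{Y}^{s_k}$). Thus under the reduced model the measurements are mutually independent, independent of $(\omega_0,\omega_{s_0})$, and unaffected by any DM's actions or policy. *)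

theory Defs
  imports "HOL-Probability.Probability"
begin

definition standard_borel :: "'a measure \<Rightarrow> bool" where
  "standard_borel M \<longleftrightarrow>
     (\<exists>X. completely_metrizable_space X \<and> separable_space X \<and> topspace X = space M \<and>
          sets M = sigma_sets (space M) {S. openin X S})"

text \<open>
  Only the underlying measurable space of a value of type \<open>measure\<close> matters, except for
  \<open>Prob\<close>. All action spaces live in one type \<open>'u\<close> and all measurement spaces in one type
  \<open>'y\<close>, so that the unions \<open>ActU\<close>, \<open>MeasU\<close> over the decision makers, which carry the actions and
  measurements of the \<open>k\<close>-th decision maker to act, can be formed. The individual spaces may
  overlap or be disjoint.
\<close>

record ('w, 'a, 'b, 'n, 'u, 'y) team =
  numDM :: nat
  Prob :: "'w measure"                                 \<comment> \<open>\<open>(\<Omega>, \<F>, P)\<close>\<close>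
  Act :: "nat \<Rightarrow> 'u measure"
  ActU :: "'u measure"
  Meas :: "nat \<Rightarrow> 'y measure"
  MeasU :: "'y measure"
  obs :: "nat \<Rightarrow> 'w \<times> (nat \<Rightarrow> 'u) \<Rightarrow> 'y"            \<comment> \<open>\<open>\<eta>\<^sup>i(\<omega>, u)\<close>\<close>
  CostSp :: "'a measure"
  cost_rv :: "'w \<Rightarrow> 'a"                                \<comment> \<open>cost-relevant \<open>\<omega>\<^sub>0\<close>\<close>
  OrdSp :: "'b measure"
  ord_rv :: "'w \<Rightarrow> 'b"                                 \<comment> \<open>order-relevant \<open>\<omega>\<close> with index \<open>s\<^sub>0\<close>\<close>
  NoiseSp :: "nat \<Rightarrow> 'n measure"
  noise_rv :: "nat \<Rightarrow> 'w \<Rightarrow> 'n"                       \<comment> \<open>measurement noise \<open>\<omega>\<^sub>i\<close>\<close>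
  cost :: "'a \<times> 'b \<times> (nat \<Rightarrow> 'u) \<Rightarrow> real"

definition DMs :: "('w, 'a, 'b, 'n, 'u, 'y) team \<Rightarrow> nat set" where
  "DMs T = {1..numDM T}"

definition ActProd :: "('w, 'a, 'b, 'n, 'u, 'y) team \<Rightarrow> (nat \<Rightarrow> 'u) measure" where
  "ActProd T = (\<Pi>\<^sub>M i\<in>DMs T. Act T i)"

definition Hist :: "('w, 'a, 'b, 'n, 'u, 'y) team \<Rightarrow> ('w \<times> (nat \<Rightarrow> 'u)) measure" where
  "Hist T = Prob T \<Otimes>\<^sub>M ActProd T"

text \<open>
  The measurement function \<open>obs T i\<close> may depend on all of \<open>\<omega>\<close>, so no further relation between
  it and \<open>noise_rv T i\<close> is imposed.
\<close>

locale nonsequential_team = prob_space "Prob T"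
  for T :: "('w, 'a, 'b, 'n, 'u, 'y) team" +
  assumes Act_standard: "\<And>i. i \<in> DMs T \<Longrightarrow> standard_borel (Act T i)"
    and Act_nonempty: "\<And>i. i \<in> DMs T \<Longrightarrow> space (Act T i) \<noteq> {}"
    and ActU_standard: "standard_borel (ActU T)"
    and ActU_space: "space (ActU T) = (\<Union>i\<in>DMs T. space (Act T i))"
    and Act_in_ActU: "\<And>i. i \<in> DMs T \<Longrightarrow> space (Act T i) \<in> sets (ActU T)"
    and Act_subspace: "\<And>i. i \<in> DMs T \<Longrightarrow>
          sets (Act T i) = sets (restrict_space (ActU T) (space (Act T i)))"
    and Meas_standard: "\<And>i. i \<in> DMs T \<Longrightarrow> standard_borel (Meas T i)"
    and MeasU_standard: "standard_borel (MeasU T)"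
    and MeasU_space: "space (MeasU T) = (\<Union>i\<in>DMs T. space (Meas T i))"
    and Meas_in_MeasU: "\<And>i. i \<in> DMs T \<Longrightarrow> space (Meas T i) \<in> sets (MeasU T)"
    and Meas_subspace: "\<And>i. i \<in> DMs T \<Longrightarrow>
          sets (Meas T i) = sets (restrict_space (MeasU T) (space (Meas T i)))"
    and obs_measurable: "\<And>i. i \<in> DMs T \<Longrightarrow> obs T i \<in> Hist T \<rightarrow>\<^sub>M Meas T i"
    and cost_rv_measurable: "cost_rv T \<in> Prob T \<rightarrow>\<^sub>M CostSp T"
    and ord_rv_measurable: "ord_rv T \<in> Prob T \<rightarrow>\<^sub>M OrdSp T"
    and noise_rv_measurable: "\<And>i. i \<in> DMs T \<Longrightarrow> noise_rv T i \<in> Prob T \<rightarrow>\<^sub>M NoiseSp T i"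
    and cost_measurable:
          "cost T \<in> borel_measurable (CostSp T \<Otimes>\<^sub>M OrdSp T \<Otimes>\<^sub>M ActProd T)"
    and cost_nonneg:
          "\<And>x. x \<in> space (CostSp T \<Otimes>\<^sub>M OrdSp T \<Otimes>\<^sub>M ActProd T) \<Longrightarrow> 0 \<le> cost T x"

definition policies :: "('w, 'a, 'b, 'n, 'u, 'y) team \<Rightarrow> (nat \<Rightarrow> 'y \<Rightarrow> 'u) set" where
  "policies T = {\<gamma>. \<forall>i\<in>DMs T. \<gamma> i \<in> Meas T i \<rightarrow>\<^sub>M Act T i}"

definition closed_loop ::
  "('w, 'a, 'b, 'n, 'u, 'y) team \<Rightarrow> (nat \<Rightarrow> 'y \<Rightarrow> 'u) \<Rightarrow> 'w \<Rightarrow> (nat \<Rightarrow> 'u) \<Rightarrow> bool" where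
  "closed_loop T \<gamma> \<omega> u \<longleftrightarrow>
     u \<in> space (ActProd T) \<and> (\<forall>i\<in>DMs T. u i = \<gamma> i (obs T i (\<omega>, u)))"

text \<open>
  The expectation under a policy \<open>\<gamma>\<close> is taken along the solution \<open>u\<close> of the closed-loop
  equations. Causality makes this solution exist and be unique for every \<open>\<omega>\<close>; without it the
  value of \<open>J\<close> below is meaningless.
\<close>

definition J :: "('w, 'a, 'b, 'n, 'u, 'y) team \<Rightarrow> (nat \<Rightarrow> 'y \<Rightarrow> 'u) \<Rightarrow> ennreal" where
  "J T \<gamma> = (\<integral>\<^sup>+\<omega>. ennreal (cost T (cost_rv T \<omega>, ord_rv T \<omega>, THE u. closed_loop T \<gamma> \<omega> u)) \<partial>Prob T)"

text \<open>
  An ordering is a list \<open>[s\<^sub>1, \<dots>, s\<^sub>k]\<close>. List positions start at \<open>0\<close>, hence \<open>s\<^sub>k\<close> is found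
  at position \<open>k - 1\<close>, and truncation to the first \<open>k\<close> entries is \<open>take k\<close>.
\<close>

definition orderings :: "('w, 'a, 'b, 'n, 'u, 'y) team \<Rightarrow> nat \<Rightarrow> nat list set" where
  "orderings T k = {s. length s = k \<and> distinct s \<and> set s \<subseteq> DMs T}"

definition ordering_map ::
  "('w, 'a, 'b, 'n, 'u, 'y) team \<Rightarrow> ('w \<times> (nat \<Rightarrow> 'u) \<Rightarrow> nat list) \<Rightarrow> bool" where
  "ordering_map T \<psi> \<longleftrightarrow>
     \<psi> \<in> space (Hist T) \<rightarrow> orderings T (numDM T) \<and>
     (\<forall>\<omega>\<in>space (Prob T). \<forall>\<omega>'\<in>space (Prob T). \<forall>u\<in>space (ActProd T).
        ord_rv T \<omega> = ord_rv T \<omega>' \<longrightarrow> \<psi> (\<omega>, u) = \<psi> (\<omega>', u))"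

definition acting :: "('w \<times> (nat \<Rightarrow> 'u) \<Rightarrow> nat list) \<Rightarrow> nat \<Rightarrow> 'w \<times> (nat \<Rightarrow> 'u) \<Rightarrow> nat" where
  "acting \<psi> k x = \<psi> x ! (k - 1)"

definition ybar ::
  "('w, 'a, 'b, 'n, 'u, 'y) team \<Rightarrow> ('w \<times> (nat \<Rightarrow> 'u) \<Rightarrow> nat list) \<Rightarrow>
     nat \<Rightarrow> 'w \<times> (nat \<Rightarrow> 'u) \<Rightarrow> 'y" where
  "ybar T \<psi> k x = obs T (acting \<psi> k x) x"

definition ubar ::
  "('w \<times> (nat \<Rightarrow> 'u) \<Rightarrow> nat list) \<Rightarrow> nat \<Rightarrow> 'w \<times> (nat \<Rightarrow> 'u) \<Rightarrow> 'u" where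
  "ubar \<psi> k x = snd x (acting \<psi> k x)"

definition Jbar ::
  "('w, 'a, 'b, 'n, 'u, 'y) team \<Rightarrow> ('w \<times> (nat \<Rightarrow> 'u) \<Rightarrow> nat list) \<Rightarrow>
     nat \<Rightarrow> ('w \<times> (nat \<Rightarrow> 'u)) measure" where
  "Jbar T \<psi> k = vimage_algebra (space (Hist T)) (ybar T \<psi> k) (MeasU T)"

definition Fstar ::
  "('w, 'a, 'b, 'n, 'u, 'y) team \<Rightarrow> ('w \<times> (nat \<Rightarrow> 'u) \<Rightarrow> nat list) \<Rightarrow>
     nat \<Rightarrow> ('w \<times> (nat \<Rightarrow> 'u)) measure" where
  "Fstar T \<psi> k =
     vimage_algebra (space (Hist T))
       (\<lambda>x. (fst x, \<lambda>j\<in>{1..k}. ubar \<psi> j x))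
       (Prob T \<Otimes>\<^sub>M (\<Pi>\<^sub>M j\<in>{1..k}. ActU T))"

definition property_C :: "('w, 'a, 'b, 'n, 'u, 'y) team \<Rightarrow> bool" where
  "property_C T \<longleftrightarrow>
     (\<exists>\<psi>. ordering_map T \<psi> \<and>
        (\<forall>k\<in>{1..numDM T}. \<forall>s\<in>orderings T k.
           {E \<inter> {x \<in> space (Hist T). take k (\<psi> x) = s} | E. E \<in> sets (Jbar T \<psi> k)}
             \<subseteq> sets (Fstar T \<psi> (k - 1))))"

text \<open>
  Measurement space of the pair formed by the measurement of the \<open>k\<close>-th decision maker to act
  and the identity of that decision maker; it is the same for every \<open>k\<close>.
\<close>

definition MeasHat :: "('w, 'a, 'b, 'n, 'u, 'y) team \<Rightarrow> ('y \<times> nat) measure" where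
  "MeasHat T = MeasU T \<Otimes>\<^sub>M count_space (DMs T)"

text \<open>
  The policy \<open>(y, i) \<mapsto> \<gamma>\<^sup>i(y)\<close> of the \<open>k\<close>-th decision maker to act is determined only for
  \<open>y\<close> in the measurement space of decision maker \<open>i\<close>. The reduction has to work for every
  measurable extension.
\<close>

definition imaginary_policy ::
  "('w, 'a, 'b, 'n, 'u, 'y) team \<Rightarrow> (nat \<Rightarrow> 'y \<Rightarrow> 'u) \<Rightarrow> (nat \<Rightarrow> 'y \<times> nat \<Rightarrow> 'u) \<Rightarrow> bool" where
  "imaginary_policy T \<gamma> \<gamma>' \<longleftrightarrow>
     (\<forall>k\<in>DMs T. \<gamma>' k \<in> MeasHat T \<rightarrow>\<^sub>M ActU T \<and>
        (\<forall>i\<in>DMs T. \<forall>y\<in>space (Meas T i). \<gamma>' k (y, i) = \<gamma> i y))"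

text \<open>
  Policies being deterministic, the law of the action given the measurement is a Dirac measure
  (\<open>return\<close>).
\<close>

definition static_cost ::
  "('w, 'a, 'b, 'n, 'u, 'y) team \<Rightarrow> (nat \<Rightarrow> ('y \<times> nat) measure) \<Rightarrow>
     ('a \<times> 'b \<times> (nat \<Rightarrow> 'y \<times> nat) \<times> (nat \<Rightarrow> 'u) \<Rightarrow> real) \<Rightarrow>
     (nat \<Rightarrow> 'y \<times> nat \<Rightarrow> 'u) \<Rightarrow> ennreal" where
  "static_cost T Q C \<gamma>' =
     (\<integral>\<^sup>+w. (\<integral>\<^sup>+y. (\<integral>\<^sup>+u. ennreal (C (fst w, snd w, y, u))
        \<partial>(\<Pi>\<^sub>M k\<in>DMs T. return (ActU T) (\<gamma>' k (y k))))
        \<partial>(\<Pi>\<^sub>M k\<in>DMs T. Q k))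
        \<partial>distr (Prob T) (CostSp T \<Otimes>\<^sub>M OrdSp T) (\<lambda>\<omega>. (cost_rv T \<omega>, ord_rv T \<omega>)))"

definition policy_independent_static_reduction ::
  "('w, 'a, 'b, 'n, 'u, 'y) team \<Rightarrow> bool" where
  "policy_independent_static_reduction T \<longleftrightarrow>
     (\<exists>(Q :: nat \<Rightarrow> ('y \<times> nat) measure)
        (C :: 'a \<times> 'b \<times> (nat \<Rightarrow> 'y \<times> nat) \<times> (nat \<Rightarrow> 'u) \<Rightarrow> real).
        (\<forall>k\<in>DMs T. prob_space (Q k) \<and> sets (Q k) = sets (MeasHat T)) \<and>
        (let D = CostSp T \<Otimes>\<^sub>M OrdSp T \<Otimes>\<^sub>M (\<Pi>\<^sub>M k\<in>DMs T. MeasHat T) \<Otimes>\<^sub>M (\<Pi>\<^sub>M k\<in>DMs T. ActU T)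
         in C \<in> borel_measurable D \<and> (\<forall>x\<in>space D. 0 \<le> C x)) \<and>
        (\<forall>\<gamma>\<in>policies T. \<forall>\<gamma>'. imaginary_policy T \<gamma> \<gamma>' \<longrightarrow> J T \<gamma> = static_cost T Q C \<gamma>'))"

end

theory Submission
  imports Defs
begin

text \<open>
  Causality makes the first \<open>k\<close> entries of the ordering and the \<open>k\<close>-th measurement a function of
  \<open>\<omega>\<close> and the first \<open>k - 1\<close> actions. Hence the closed loop has exactly one solution for every \<open>\<omega>\<close>,
  obtained by letting the decision makers act one after the other.

  Fix a value \<open>y\<close> of the vector of pairs (measurement, identity). It determines an ordering and
  the measurement of every decision maker, hence, under a policy \<open>\<gamma>\<close>, a profile of actions
  \<open>v\<^sub>y\<close>. Let \<open>B\<^sub>y\<close> be the set of histories that produce \<open>y\<close>; it does not depend on \<open>\<gamma>\<close>. If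
  \<open>(\<omega>, v\<^sub>y) \<in> B\<^sub>y\<close>, then \<open>v\<^sub>y\<close> solves the closed loop at \<open>\<omega>\<close>, so this happens for precisely one
  \<open>y\<close>, and the cost incurred at \<open>\<omega>\<close> is the countable sum over \<open>y\<close> of
  \<open>c(\<omega>\<^sub>0, \<omega>\<^sub>s\<^sub>0, v\<^sub>y) 1{(\<omega>, v\<^sub>y) \<in> B\<^sub>y}\<close>. Conditioning on \<open>(\<omega>\<^sub>0, \<omega>\<^sub>s\<^sub>0)\<close> replaces the indicator by a
  density \<open>g\<^sub>y(\<omega>\<^sub>0, \<omega>\<^sub>s\<^sub>0, v\<^sub>y)\<close>. With measures \<open>Q\<^sub>k\<close> of full support on the countable measurement
  space, the sum is an integral against the product of the \<open>Q\<^sub>k\<close>, with cost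
  \<open>c g\<^sub>y\<close> divided by the mass of \<open>y\<close>.
\<close>

section \<open>Conditional probabilities that depend measurably on a parameter\<close>

text \<open>On the set where \<open>h\<close> exceeds 1 the excess \<open>h - 1\<close> has integral
  at most 0, so it vanishes almost everywhere. Finiteness makes the subtraction of integrals
  legitimate.\<close>

lemma (in finite_measure) AE_le_one_of_set_integral_le:
  fixes h :: "'a \<Rightarrow> ennreal"
  assumes [measurable]: "h \<in> borel_measurable M"
    and le: "\<And>A. A \<in> sets M \<Longrightarrow> (\<integral>\<^sup>+x. h x * indicator A x \<partial>M) \<le> emeasure M A"
  shows "AE x in M. h x \<le> 1"
proof -
  define A where "A = {x \<in> space M. 1 < h x}"
  have A[measurable]: "A \<in> sets M" unfolding A_def by measurable
  have "(\<integral>\<^sup>+x. h x * indicator A x - indicator A x \<partial>M)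
      = (\<integral>\<^sup>+x. h x * indicator A x \<partial>M) - (\<integral>\<^sup>+x. indicator A x \<partial>M)"
  proof (rule nn_integral_diff)
    show "(\<integral>\<^sup>+x. indicator A x \<partial>M) \<noteq> \<infinity>" by simp
  qed (auto simp: A_def indicator_def)
  also have "\<dots> = 0"
  proof -
    have "(\<integral>\<^sup>+x. h x * indicator A x \<partial>M) < \<top>"
      by (rule le_less_trans[OF le[OF A]]) (simp add: less_top[symmetric])
    then show ?thesis using le[OF A] by (simp add: diff_eq_0_iff_ennreal)
  qed
  finally have "AE x in M. h x * indicator A x - indicator A x = 0"
    by (subst (asm) nn_integral_0_iff_AE) auto
  with AE_space show ?thesis
  proof eventually_elim
    case (elim x)
    then show ?case
      by (cases "1 < h x") (auto simp: A_def diff_eq_0_iff_ennreal)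
  qed
qed

text \<open>
  A version of the conditional probability of the section \<open>{\<omega>. (\<omega>, v) \<in> E}\<close> given \<open>X\<close> that is jointly
  measurable in the value of \<open>X\<close> and the parameter \<open>v\<close>. No regular conditional distribution is
  available, as \<open>M\<close> is an arbitrary measurable space: the sets \<open>E\<close> for which such a
  version exists form a Dynkin system.
\<close>

lemma parametric_conditional_probability:
  assumes "prob_space P" and X[measurable]: "X \<in> P \<rightarrow>\<^sub>M M" and E: "E \<in> sets (P \<Otimes>\<^sub>M V)"
  obtains g :: "'x \<times> 'v \<Rightarrow> ennreal"
    where "g \<in> borel_measurable (M \<Otimes>\<^sub>M V)" and "\<And>z. g z \<le> 1"
      and "\<And>v f. v \<in> space V \<Longrightarrow> f \<in> borel_measurable M \<Longrightarrow>
        (\<integral>\<^sup>+\<omega>. f (X \<omega>) * indicator E (\<omega>, v) \<partial>P) = (\<integral>\<^sup>+x. f x * g (x, v) \<partial>distr P M X)"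
proof -
  interpret P: prob_space P by fact
  define D where "D = distr P M X"
  interpret D: prob_space D unfolding D_def by (rule P.prob_space_distr) fact
  have [measurable_cong, simp]: "sets D = sets M" by (simp add: D_def)
  have spD[simp]: "space D = space M" by (simp add: D_def)
  define G where "G = {F \<times> W | F W. F \<in> sets P \<and> W \<in> sets V}"
  define S where "S = space P \<times> space V"
  have sets_eq: "sets (P \<Otimes>\<^sub>M V) = sigma_sets S G"
    unfolding sets_pair_measure G_def S_def ..
  \<comment> \<open>The identity is first required for indicators only, which suits the Dynkin
    argument; general \<open>f\<close> follows at the end.\<close>
  define cond where "cond E g \<longleftrightarrow> g \<in> borel_measurable (M \<Otimes>\<^sub>M V) \<and>
      (\<forall>v\<in>space V. \<forall>A\<in>sets M.
        (\<integral>\<^sup>+\<omega>. indicator A (X \<omega>) * indicator E (\<omega>, v) \<partial>P) = (\<integral>\<^sup>+x. g (x, v) * indicator A x \<partial>D))"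
    for E and g :: "'x \<times> 'v \<Rightarrow> ennreal"
  have indX: "(\<integral>\<^sup>+\<omega>. indicator A (X \<omega>) \<partial>P) = emeasure D A" if "A \<in> sets M" for A
  proof -
    have "emeasure D A = (\<integral>\<^sup>+x. indicator A x \<partial>D)" using that by simp
    also have "\<dots> = (\<integral>\<^sup>+\<omega>. indicator A (X \<omega>) \<partial>P)"
      unfolding D_def using that by (intro nn_integral_distr) auto
    finally show ?thesis by simp
  qed
  \<comment> \<open>For each \<open>v\<close>, a version is at most 1 almost everywhere, because its
    integral over \<open>A\<close> is bounded by the mass of \<open>A\<close> under the law of
    \<open>X\<close>. Truncation therefore changes no integral and makes the bound hold
    everywhere.\<close>
  have cap: "cond E (\<lambda>z. min (g z) 1)" if g: "cond E g" for E g
  proof -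
    from g have [measurable]: "g \<in> borel_measurable (M \<Otimes>\<^sub>M V)" by (simp add: cond_def)
    have "(\<integral>\<^sup>+x. g (x, v) * indicator A x \<partial>D) = (\<integral>\<^sup>+x. min (g (x, v)) 1 * indicator A x \<partial>D)"
      if v: "v \<in> space V" and A: "A \<in> sets M" for v A
    proof (rule nn_integral_cong_AE)
      have "AE x in D. g (x, v) \<le> 1"
      proof (rule D.AE_le_one_of_set_integral_le)
        show "(\<lambda>x. g (x, v)) \<in> borel_measurable D" using v by measurable
        fix B assume B: "B \<in> sets D"
        then have "(\<integral>\<^sup>+x. g (x, v) * indicator B x \<partial>D)
            = (\<integral>\<^sup>+\<omega>. indicator B (X \<omega>) * indicator E (\<omega>, v) \<partial>P)"
          using g v by (simp add: cond_def)
        also have "\<dots> \<le> (\<integral>\<^sup>+\<omega>. indicator B (X \<omega>) \<partial>P)"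
          by (intro nn_integral_mono) (auto simp: indicator_def)
        finally show "(\<integral>\<^sup>+x. g (x, v) * indicator B x \<partial>D) \<le> emeasure D B"
          using B by (simp add: indX)
      qed
      then show "AE x in D. g (x, v) * indicator A x = min (g (x, v)) 1 * indicator A x"
        by eventually_elim (simp add: min_def)
    qed
    then show ?thesis using g by (auto simp: cond_def)
  qed
  \<comment> \<open>The bound by 1 is carried through the induction so that \<open>1 - g\<close> is
    a genuine difference in the case of complements.\<close>
  have "\<exists>g. cond E g \<and> (\<forall>z. g z \<le> 1)"
    using Int_stable_pair_measure_generator pair_measure_closed E[unfolded sets_eq G_def S_def]
    unfolding sets_eq
  proof (induction rule: sigma_sets_induct_disjoint)
    case (basic E)
    then obtain F W where E: "E = F \<times> W" and [measurable]: "F \<in> sets P" "W \<in> sets V" by blast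
    \<comment> \<open>\<open>N\<close> sends \<open>A\<close> to the probability of \<open>F\<close>
      together with \<open>X\<close> lying in \<open>A\<close>. Its Radon-Nikodym derivative with
      respect to \<open>D\<close> is the conditional probability of \<open>F\<close> given
      \<open>X\<close>; the parameter only adds the factor \<open>indicator W v\<close>.\<close>
    define N where "N = distr (density P (indicator F)) M X"
    have "absolutely_continuous D N"
      unfolding absolutely_continuous_def
    proof
      fix A assume "A \<in> null_sets D"
      then have [measurable]: "A \<in> sets M" and "emeasure D A = 0" by auto
      then have "(\<integral>\<^sup>+\<omega>. indicator A (X \<omega>) \<partial>P) = 0" by (simp add: indX)
      moreover have "emeasure N A \<le> (\<integral>\<^sup>+\<omega>. indicator A (X \<omega>) \<partial>P)"
        by (auto simp: N_def emeasure_distr emeasure_density intro!: nn_integral_mono split: split_indicator)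
      ultimately show "A \<in> null_sets N" by (auto simp: N_def)
    qed
    then obtain h where [measurable]: "h \<in> borel_measurable D" and h: "density D h = N"
      using D.Radon_Nikodym[of N] by (auto simp: N_def)
    have "cond E (\<lambda>(x, v). h x * indicator W v)"
      unfolding cond_def
    proof (intro conjI ballI)
      fix v A assume v: "v \<in> space V" and [measurable]: "A \<in> sets M"
      have "(\<integral>\<^sup>+x. h x * indicator A x \<partial>D) = emeasure N A"
        by (subst h[symmetric], subst emeasure_density) auto
      also have "\<dots> = (\<integral>\<^sup>+\<omega>. indicator A (X \<omega>) * indicator F \<omega> \<partial>P)"
        by (auto simp: N_def emeasure_distr emeasure_density intro!: nn_integral_cong split: split_indicator)
      finally show "(\<integral>\<^sup>+\<omega>. indicator A (X \<omega>) * indicator E (\<omega>, v) \<partial>P)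
          = (\<integral>\<^sup>+x. (case (x, v) of (x, v) \<Rightarrow> h x * indicator W v) * indicator A x \<partial>D)"
        by (cases "v \<in> W") (simp_all add: E indicator_times)
    qed measurable
    from cap[OF this] show ?case by (intro exI conjI) auto
  next
    case empty
    show ?case by (intro exI[of _ "\<lambda>_. 0"]) (simp add: cond_def)
  next
    case (compl E)
    then have [measurable]: "E \<in> sets (P \<Otimes>\<^sub>M V)" by (simp add: sets_eq G_def S_def)
    from compl obtain g where g: "cond E g" and le: "\<And>z. g z \<le> 1" by blast
    from g have [measurable]: "g \<in> borel_measurable (M \<Otimes>\<^sub>M V)" by (simp add: cond_def)
    have "cond (space P \<times> space V - E) (\<lambda>z. 1 - g z)"
      unfolding cond_def
    proof (intro conjI ballI)
      fix v A assume v[measurable]: "v \<in> space V" and A[measurable]: "A \<in> sets M"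
      have [measurable]: "(\<lambda>\<omega>. indicator E (\<omega>, v) :: ennreal) \<in> borel_measurable P"
        "(\<lambda>x. g (x, v)) \<in> borel_measurable D"
        using v by measurable
      have "(\<integral>\<^sup>+\<omega>. indicator A (X \<omega>) * indicator (space P \<times> space V - E) (\<omega>, v) \<partial>P)
          = (\<integral>\<^sup>+\<omega>. indicator A (X \<omega>) - indicator A (X \<omega>) * indicator E (\<omega>, v) \<partial>P)"
        using v by (intro nn_integral_cong) (auto simp: indicator_def)
      also have "\<dots> = emeasure D A - (\<integral>\<^sup>+\<omega>. indicator A (X \<omega>) * indicator E (\<omega>, v) \<partial>P)"
      proof (subst nn_integral_diff)
        have "(\<integral>\<^sup>+\<omega>. indicator A (X \<omega>) * indicator E (\<omega>, v) \<partial>P) \<le> (\<integral>\<^sup>+\<omega>. indicator A (X \<omega>) \<partial>P)"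
          by (intro nn_integral_mono) (auto simp: indicator_def)
        then show "(\<integral>\<^sup>+\<omega>. indicator A (X \<omega>) * indicator E (\<omega>, v) \<partial>P) \<noteq> \<infinity>"
          using D.emeasure_finite[of A] by (auto simp: indX[OF A] top_unique)
      qed (simp_all add: indX, auto simp: indicator_def)
      also have "\<dots> = emeasure D A - (\<integral>\<^sup>+x. g (x, v) * indicator A x \<partial>D)"
        using g v A by (simp add: cond_def)
      also have "\<dots> = (\<integral>\<^sup>+x. indicator A x - g (x, v) * indicator A x \<partial>D)"
      proof (subst nn_integral_diff)
        have "(\<integral>\<^sup>+x. g (x, v) * indicator A x \<partial>D) \<le> (\<integral>\<^sup>+x. indicator A x \<partial>D)"
          using le by (intro nn_integral_mono) (auto simp: indicator_def)
        then show "(\<integral>\<^sup>+x. g (x, v) * indicator A x \<partial>D) \<noteq> \<infinity>"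
          using D.emeasure_finite[of A] by (auto simp: top_unique)
      qed (use le in \<open>auto simp: indicator_def\<close>)
      also have "\<dots> = (\<integral>\<^sup>+x. (1 - g (x, v)) * indicator A x \<partial>D)"
        by (intro nn_integral_cong) (auto simp: indicator_def)
      finally show "(\<integral>\<^sup>+\<omega>. indicator A (X \<omega>) * indicator (space P \<times> space V - E) (\<omega>, v) \<partial>P)
          = (\<integral>\<^sup>+x. (1 - g (x, v)) * indicator A x \<partial>D)" .
    qed measurable
    then show ?case by (intro exI conjI allI) (auto simp: diff_le_self_ennreal)
  next
    case (union E)
    then have E[measurable]: "\<And>n. E n \<in> sets (P \<Otimes>\<^sub>M V)" by (auto simp: sets_eq G_def S_def)
    from union have "\<forall>n. \<exists>g. cond (E n) g" by blast
    then obtain g where g: "\<And>n. cond (E n) (g n)" by metis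
    then have [measurable]: "\<And>n. g n \<in> borel_measurable (M \<Otimes>\<^sub>M V)" by (simp add: cond_def)
    have "cond (\<Union>n. E n) (\<lambda>z. \<Sum>n. g n z)"
      unfolding cond_def
    proof (intro conjI ballI)
      fix v A assume v[measurable]: "v \<in> space V" and A[measurable]: "A \<in> sets M"
      have [measurable]: "\<And>n. (\<lambda>\<omega>. indicator (E n) (\<omega>, v) :: ennreal) \<in> borel_measurable P"
        "\<And>n. (\<lambda>x. g n (x, v)) \<in> borel_measurable D"
        using v by measurable
      have "(\<integral>\<^sup>+\<omega>. indicator A (X \<omega>) * indicator (\<Union>n. E n) (\<omega>, v) \<partial>P)
          = (\<integral>\<^sup>+\<omega>. (\<Sum>n. indicator A (X \<omega>) * indicator (E n) (\<omega>, v)) \<partial>P)"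
        using suminf_indicator[OF union(1)] by (intro nn_integral_cong) simp
      also have "\<dots> = (\<Sum>n. \<integral>\<^sup>+\<omega>. indicator A (X \<omega>) * indicator (E n) (\<omega>, v) \<partial>P)"
        by (rule nn_integral_suminf) measurable
      also have "\<dots> = (\<Sum>n. \<integral>\<^sup>+x. g n (x, v) * indicator A x \<partial>D)"
        using g v A by (simp add: cond_def)
      also have "\<dots> = (\<integral>\<^sup>+x. (\<Sum>n. g n (x, v) * indicator A x) \<partial>D)"
        by (rule nn_integral_suminf[symmetric]) measurable
      finally show "(\<integral>\<^sup>+\<omega>. indicator A (X \<omega>) * indicator (\<Union>n. E n) (\<omega>, v) \<partial>P)
          = (\<integral>\<^sup>+x. (\<Sum>n. g n (x, v)) * indicator A x \<partial>D)"
        by simp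
    qed measurable
    from cap[OF this] show ?case by (intro exI conjI) auto
  qed
  then obtain g where g: "cond E g" and le: "\<And>z. g z \<le> 1" by blast
  then have gm[measurable]: "g \<in> borel_measurable (M \<Otimes>\<^sub>M V)" by (simp add: cond_def)
  note [measurable] = E
  have "(\<integral>\<^sup>+\<omega>. f (X \<omega>) * indicator E (\<omega>, v) \<partial>P) = (\<integral>\<^sup>+x. f x * g (x, v) \<partial>D)"
    if v[measurable]: "v \<in> space V" and f[measurable]: "f \<in> borel_measurable M" for v f
  proof -
    have [measurable]: "(\<lambda>\<omega>. indicator E (\<omega>, v) :: ennreal) \<in> borel_measurable P"
        "(\<lambda>x. g (x, v)) \<in> borel_measurable D"
      using v by measurable
    \<comment> \<open>The identity for indicators says that these two measures coincide; integrating
      \<open>f\<close> against both gives the general identity.\<close>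
    have eq: "distr (density P (\<lambda>\<omega>. indicator E (\<omega>, v))) M X = density D (\<lambda>x. g (x, v))"
    proof (rule measure_eqI)
      fix A assume "A \<in> sets (distr (density P (\<lambda>\<omega>. indicator E (\<omega>, v))) M X)"
      then have A[measurable]: "A \<in> sets M" by simp
      have "emeasure (distr (density P (\<lambda>\<omega>. indicator E (\<omega>, v))) M X) A
          = (\<integral>\<^sup>+\<omega>. indicator A (X \<omega>) * indicator E (\<omega>, v) \<partial>P)"
        by (auto simp: emeasure_distr emeasure_density intro!: nn_integral_cong split: split_indicator)
      also have "\<dots> = (\<integral>\<^sup>+x. g (x, v) * indicator A x \<partial>D)"
        using g v A by (simp add: cond_def)
      finally show "emeasure (distr (density P (\<lambda>\<omega>. indicator E (\<omega>, v))) M X) A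
          = emeasure (density D (\<lambda>x. g (x, v))) A"
        by (simp add: emeasure_density)
    qed simp
    have "(\<integral>\<^sup>+\<omega>. f (X \<omega>) * indicator E (\<omega>, v) \<partial>P)
        = (\<integral>\<^sup>+x. f x \<partial>distr (density P (\<lambda>\<omega>. indicator E (\<omega>, v))) M X)"
      by (simp add: nn_integral_distr nn_integral_density mult.commute)
    also have "\<dots> = (\<integral>\<^sup>+x. f x * g (x, v) \<partial>D)"
      unfolding eq by (simp add: nn_integral_density mult.commute)
    finally show ?thesis .
  qed
  then show thesis using that[OF gm le] by (simp add: D_def)
qed

section \<open>Countable measurable spaces and measures of full support\<close>

text \<open>Points are closed in a metrizable space, and closed sets are Borel.\<close>

lemma standard_borel_singleton_in_sets:
  assumes "standard_borel M" and x: "x \<in> space M"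
  shows "{x} \<in> sets M"
proof -
  from assms obtain X where X: "completely_metrizable_space X" and sp: "topspace X = space M"
    and sets: "sets M = sigma_sets (space M) {S. openin X S}"
    unfolding standard_borel_def by blast
  have "closedin X {x}"
    using completely_metrizable_imp_metrizable_space[OF X] x sp
    by (intro closedin_t1_singleton Hausdorff_imp_t1_space metrizable_imp_Hausdorff_space) simp_all
  then have "openin X (space M - {x})" by (simp add: closedin_def sp)
  then have "space M - {x} \<in> sets M" by (auto simp: sets)
  from sets.compl_sets[OF this] show ?thesis
    using x by (simp add: Diff_Diff_Int Int_absorb1)
qed

lemma sets_eq_Pow_of_countable:
  assumes "countable (space M)" and "\<And>x. x \<in> space M \<Longrightarrow> {x} \<in> sets M"
  shows "sets M = Pow (space M)"
proof (intro equalityI subsetI)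
  fix A assume "A \<in> Pow (space M)"
  then show "A \<in> sets M"
    using assms countable_subset[of A "space M"] by - (rule sets.countable, blast+)
qed (auto dest: sets.sets_into_space)

text \<open>The geometric law charges every natural number, and \<open>from_nat_into S\<close> maps
  the naturals onto \<open>S\<close>.\<close>

lemma full_support_prob_space:
  assumes "countable S" and "S \<noteq> {}"
  obtains Q where "prob_space Q" and "sets Q = Pow S" and "\<And>x. x \<in> S \<Longrightarrow> 0 < emeasure Q {x}"
proof -
  define p where "p = map_pmf (from_nat_into S) (geometric_pmf (1/2))"
  have S: "set_pmf p = S"
    using range_from_nat_into[OF assms(2,1)] by (simp add: p_def set_pmf_geometric)
  \<comment> \<open>The push-forward moves \<open>p\<close> from the whole type to \<open>S\<close>.
    The default value only makes the map land in \<open>S\<close>; \<open>p\<close> puts no mass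
    outside.\<close>
  define Q where "Q = distr (measure_pmf p) (count_space S) (\<lambda>x. if x \<in> S then x else from_nat_into S 0)"
  have m: "(\<lambda>x. if x \<in> S then x else from_nat_into S 0) \<in> measure_pmf p \<rightarrow>\<^sub>M count_space S"
    using from_nat_into[OF assms(2)] by auto
  show thesis
  proof
    show "prob_space Q"
      unfolding Q_def by (rule prob_space.prob_space_distr[OF prob_space_measure_pmf m])
    show "sets Q = Pow S" by (simp add: Q_def)
    fix x assume x: "x \<in> S"
    have "0 < emeasure (measure_pmf p) {x}"
      using x S by (simp add: emeasure_pmf_single pmf_positive)
    also have "\<dots> \<le> emeasure Q {x}"
      unfolding Q_def using m x by (subst emeasure_distr) (auto intro!: emeasure_mono)
    finally show "0 < emeasure Q {x}" .
  qed
qed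

lemma countable_PiM:
  assumes "finite I" and "\<And>i. i \<in> I \<Longrightarrow> countable (space (M i))"
    and "\<And>i. i \<in> I \<Longrightarrow> sets (M i) = Pow (space (M i))"
  shows "countable (space (PiM I M))" and "sets (PiM I M) = Pow (space (PiM I M))"
proof -
  show c: "countable (space (PiM I M))"
    using assms by (simp add: space_PiM countable_PiE)
  show "sets (PiM I M) = Pow (space (PiM I M))"
  proof (rule sets_eq_Pow_of_countable[OF c])
    fix x assume x: "x \<in> space (PiM I M)"
    then have "PiE I (\<lambda>i. {x i}) = {x}"
      by (intro PiE_singleton) (auto simp: space_PiM PiE_iff)
    moreover have "PiE I (\<lambda>i. {x i}) \<in> sets (PiM I M)"
      using x assms by (intro sets_PiM_I_finite) (auto simp: space_PiM PiE_iff)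
    ultimately show "{x} \<in> sets (PiM I M)" by simp
  qed
qed

lemma nn_integral_countable_space:
  assumes "countable (space M)" and s: "sets M = Pow (space M)"
  shows "(\<integral>\<^sup>+x. f x \<partial>M) = (\<integral>\<^sup>+x. f x * emeasure M {x} \<partial>count_space (space M))"
proof -
  have "M = density (count_space (space M)) (\<lambda>x. emeasure M {x})"
  proof (rule measure_eqI_countable[OF s _ assms(1)])
    fix a assume "a \<in> space M"
    then show "emeasure M {a} = emeasure (density (count_space (space M)) (\<lambda>x. emeasure M {x})) {a}"
      by (simp add: emeasure_density)
  qed simp
  then have "(\<integral>\<^sup>+x. f x \<partial>M) = (\<integral>\<^sup>+x. f x \<partial>density (count_space (space M)) (\<lambda>x. emeasure M {x}))"
    by simp
  also have "\<dots> = (\<integral>\<^sup>+x. f x * emeasure M {x} \<partial>count_space (space M))"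
    by (subst nn_integral_density) (simp_all add: mult.commute)
  finally show ?thesis .
qed

lemma PiM_singleton_pos:
  fixes Q :: "'i \<Rightarrow> 'a measure"
  assumes "finite I" and Q: "\<And>i. i \<in> I \<Longrightarrow> prob_space (Q i)"
    and s: "\<And>i x. i \<in> I \<Longrightarrow> x \<in> space (Q i) \<Longrightarrow> {x} \<in> sets (Q i) \<and> 0 < emeasure (Q i) {x}"
    and y: "y \<in> space (PiM I Q)"
  shows "0 < emeasure (PiM I Q) {y}"
proof -
  \<comment> \<open>\<open>product_sigma_finite\<close> speaks of all indices, so indices outside
    \<open>I\<close> receive an arbitrary probability measure.\<close>
  define Q' where "Q' i = (if i \<in> I then Q i else return (count_space UNIV) undefined)" for i
  have "prob_space (Q' i)" for i
    using Q by (auto simp: Q'_def intro!: prob_space_return)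
  then interpret product_sigma_finite Q'
    by (simp add: product_sigma_finite_def prob_space_imp_sigma_finite)
  have eq: "PiM I Q = PiM I Q'" by (rule PiM_cong) (simp_all add: Q'_def)
  have "PiE I (\<lambda>i. {y i}) = {y}"
    using y by (intro PiE_singleton) (auto simp: space_PiM PiE_iff)
  then have "emeasure (PiM I Q) {y} = emeasure (PiM I Q') (PiE I (\<lambda>i. {y i}))" by (simp add: eq)
  also have "\<dots> = (\<Prod>i\<in>I. emeasure (Q i) {y i})"
    using s y \<open>finite I\<close> by (subst emeasure_PiM) (auto simp: Q'_def space_PiM PiE_iff intro!: prod.cong)
  also have "\<dots> > 0"
  proof -
    have "\<forall>i\<in>I. emeasure (Q i) {y i} \<noteq> 0"
      using s y by (fastforce simp: space_PiM PiE_iff)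
    then have "(\<Prod>i\<in>I. emeasure (Q i) {y i}) \<noteq> 0" using \<open>finite I\<close> by simp
    then show ?thesis by (simp add: zero_less_iff_neq_zero)
  qed
  finally show ?thesis .
qed

section \<open>Consequences of causality for a fixed ordering map\<close>

locale causal_team = nonsequential_team T
  for T :: "('w, 'a, 'b, 'n, 'u, 'y) team" +
  fixes \<psi> :: "'w \<times> (nat \<Rightarrow> 'u) \<Rightarrow> nat list"
  assumes ordering: "ordering_map T \<psi>"
    and causal: "\<And>k s. k \<in> {1..numDM T} \<Longrightarrow> s \<in> orderings T k \<Longrightarrow>
        {E \<inter> {x \<in> space (Hist T). take k (\<psi> x) = s} | E. E \<in> sets (Jbar T \<psi> k)}
          \<subseteq> sets (Fstar T \<psi> (k - 1))"
begin

lemma finite_DMs [simp]: "finite (DMs T)" and card_DMs [simp]: "card (DMs T) = numDM T"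
  by (simp_all add: DMs_def)

lemma full_ordering:
  assumes "s \<in> orderings T (numDM T)"
  shows "length s = numDM T" "distinct s" "set s = DMs T"
proof -
  from assms show s: "length s = numDM T" "distinct s" by (auto simp: orderings_def)
  show "set s = DMs T"
    using assms s distinct_card[of s] by (intro card_subset_eq) (auto simp: orderings_def)
qed

lemma psi_ordering: "x \<in> space (Hist T) \<Longrightarrow> \<psi> x \<in> orderings T (numDM T)"
  using ordering by (auto simp: ordering_map_def)

lemmas psi_props = full_ordering[OF psi_ordering]

lemma psi_nth_in_DMs: "x \<in> space (Hist T) \<Longrightarrow> k < numDM T \<Longrightarrow> \<psi> x ! k \<in> DMs T"
  using psi_props[of x] nth_mem[of k "\<psi> x"] by simp

lemma take_psi_ordering:
  "x \<in> space (Hist T) \<Longrightarrow> k \<le> numDM T \<Longrightarrow> take k (\<psi> x) \<in> orderings T k"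
  using psi_props[of x] set_take_subset[of k "\<psi> x"] by (auto simp: orderings_def)

lemma space_Hist: "x \<in> space (Hist T) \<longleftrightarrow> fst x \<in> space (Prob T) \<and> snd x \<in> space (ActProd T)"
  by (cases x) (simp add: Hist_def space_pair_measure)

lemma ActProd_component: "u \<in> space (ActProd T) \<Longrightarrow> i \<in> DMs T \<Longrightarrow> u i \<in> space (Act T i)"
  by (auto simp: ActProd_def space_PiM)

lemma obs_in_space: "x \<in> space (Hist T) \<Longrightarrow> i \<in> DMs T \<Longrightarrow> obs T i x \<in> space (Meas T i)"
  using measurable_space[OF obs_measurable] by blast

lemma Act_measurable_ActU: "i \<in> DMs T \<Longrightarrow> f \<in> M \<rightarrow>\<^sub>M Act T i \<Longrightarrow> f \<in> M \<rightarrow>\<^sub>M ActU T"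
  by (metis measurable_cong_sets[OF refl Act_subspace] measurable_restrict_space2_iff)

lemma action_measurable:
  assumes "i \<in> DMs T"
  shows "(\<lambda>x. snd x i) \<in> Hist T \<rightarrow>\<^sub>M ActU T"
  unfolding Hist_def ActProd_def
  by (rule Act_measurable_ActU[OF assms], rule measurable_compose[OF measurable_snd])
     (rule measurable_component_singleton[OF assms])

text \<open>The map that generates \<open>Fstar T \<psi> k\<close>: histories with the same value
  cannot be told apart by \<omega> and the first \<open>k\<close> actions.\<close>

definition past :: "nat \<Rightarrow> 'w \<times> (nat \<Rightarrow> 'u) \<Rightarrow> 'w \<times> (nat \<Rightarrow> 'u)" where
  "past k x = (fst x, \<lambda>j\<in>{1..k}. ubar \<psi> j x)"

lemma past_funcset:
  assumes "k \<le> numDM T"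
  shows "past k \<in> space (Hist T) \<rightarrow> space (Prob T \<Otimes>\<^sub>M (\<Pi>\<^sub>M j\<in>{1..k}. ActU T))"
proof
  fix x assume x: "x \<in> space (Hist T)"
  have "ubar \<psi> j x \<in> space (ActU T)" if "j \<in> {1..k}" for j
  proof -
    have "\<psi> x ! (j - 1) \<in> DMs T" using that assms by (intro psi_nth_in_DMs[OF x]) auto
    then show ?thesis
      using x ActProd_component[of "snd x"] by (auto simp: ubar_def acting_def ActU_space space_Hist)
  qed
  then show "past k x \<in> space (Prob T \<Otimes>\<^sub>M (\<Pi>\<^sub>M j\<in>{1..k}. ActU T))"
    using x by (simp add: past_def space_pair_measure space_PiM space_Hist)
qed

lemma sets_Fstar:
  assumes "k \<le> numDM T"
  shows "sets (Fstar T \<psi> k)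
    = {past k -` A \<inter> space (Hist T) | A. A \<in> sets (Prob T \<Otimes>\<^sub>M (\<Pi>\<^sub>M j\<in>{1..k}. ActU T))}"
  using sets_vimage_algebra2[OF past_funcset[OF assms]]
  by (simp add: Fstar_def past_def[abs_def])

lemma past_cong:
  assumes "fst x = fst x'" "take k (\<psi> x') = take k (\<psi> x)" "\<And>j. j < k \<Longrightarrow> snd x (\<psi> x ! j) = snd x' (\<psi> x ! j)"
  shows "past k x = past k x'"
proof -
  have "ubar \<psi> j x = ubar \<psi> j x'" if "j \<in> {1..k}" for j
  proof -
    from that have "j - 1 < k" by auto
    then have "\<psi> x' ! (j - 1) = \<psi> x ! (j - 1)" using assms(2) by (metis nth_take)
    with assms(3) \<open>j - 1 < k\<close> show ?thesis by (simp add: ubar_def acting_def)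
  qed
  with assms(1) show ?thesis by (auto simp: past_def restrict_def)
qed

text \<open>Causality for the decision maker at list position \<open>k\<close>, who is number
  \<open>Suc k\<close> to act: with the first \<open>Suc k\<close> entries of the ordering fixed,
  its measurement events are decided by \<open>past k\<close>.\<close>

lemma Jbar_event_past:
  assumes "k < numDM T" and "s \<in> orderings T (Suc k)" and "E \<in> sets (Jbar T \<psi> (Suc k))"
  obtains A where "A \<in> sets (Prob T \<Otimes>\<^sub>M (\<Pi>\<^sub>M j\<in>{1..k}. ActU T))"
    and "E \<inter> {x \<in> space (Hist T). take (Suc k) (\<psi> x) = s} = past k -` A \<inter> space (Hist T)"
proof -
  have "E \<inter> {x \<in> space (Hist T). take (Suc k) (\<psi> x) = s} \<in> sets (Fstar T \<psi> k)"
    using causal[of "Suc k" s] assms by auto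
  then show thesis using that sets_Fstar[of k] assms(1) by auto
qed

lemma space_in_Jbar: "space (Hist T) \<in> sets (Jbar T \<psi> k)"
  using sets.top[of "Jbar T \<psi> k"] by (simp add: Jbar_def)

lemma obs_event_in_Jbar:
  assumes "y \<in> space (MeasU T)"
  shows "ybar T \<psi> k -` {y} \<inter> space (Hist T) \<in> sets (Jbar T \<psi> k)"
  unfolding Jbar_def
  by (rule in_vimage_algebra) (rule standard_borel_singleton_in_sets[OF MeasU_standard assms])

text \<open>Both histories have the same \<open>past k\<close>, so no event supplied by
  \<open>Jbar_event_past\<close> separates them. The whole space as \<open>E\<close> gives the next
  entry of the ordering; the fibre of \<open>ybar\<close> through \<open>x\<close> gives the next
  measurement.\<close>

lemma causal_step:
  assumes x: "x \<in> space (Hist T)" "x' \<in> space (Hist T)" and fst: "fst x = fst x'" and k: "k < numDM T"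
    and take: "take k (\<psi> x') = take k (\<psi> x)"
    and agree: "\<And>j. j < k \<Longrightarrow> snd x (\<psi> x ! j) = snd x' (\<psi> x ! j)"
  shows "take (Suc k) (\<psi> x') = take (Suc k) (\<psi> x)"
    and "obs T (\<psi> x ! k) x' = obs T (\<psi> x ! k) x"
proof -
  have past: "past k x = past k x'" by (rule past_cong[OF fst take agree])
  let ?s = "take (Suc k) (\<psi> x)"
  have s: "?s \<in> orderings T (Suc k)" using take_psi_ordering[OF x(1), of "Suc k"] k by simp
  have iff: "x \<in> E \<inter> {x \<in> space (Hist T). take (Suc k) (\<psi> x) = ?s}
      \<Longrightarrow> x' \<in> E \<inter> {x \<in> space (Hist T). take (Suc k) (\<psi> x) = ?s}"
    if "E \<in> sets (Jbar T \<psi> (Suc k))" for E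
    by (rule Jbar_event_past[OF k s that]) (use past x in auto)
  show t: "take (Suc k) (\<psi> x') = take (Suc k) (\<psi> x)"
    using iff[OF space_in_Jbar] x by simp
  then have nth: "\<psi> x' ! k = \<psi> x ! k" by (metis lessI nth_take)
  have "ybar T \<psi> (Suc k) x \<in> space (MeasU T)"
    using obs_in_space[OF x(1) psi_nth_in_DMs[OF x(1) k]] psi_nth_in_DMs[OF x(1) k]
    by (auto simp: ybar_def acting_def MeasU_space)
  from iff[OF obs_event_in_Jbar[OF this]] have "ybar T \<psi> (Suc k) x' = ybar T \<psi> (Suc k) x"
    using x by simp
  then show "obs T (\<psi> x ! k) x' = obs T (\<psi> x ! k) x"
    by (simp add: ybar_def acting_def nth)
qed

text \<open>Agreement is assumed along the ordering at \<open>x\<close> only; the induction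
  hypothesis transfers each initial segment to \<open>x'\<close>, as \<open>causal_step\<close>
  requires.\<close>

lemma take_psi_cong:
  assumes x: "x \<in> space (Hist T)" "x' \<in> space (Hist T)" and fst: "fst x = fst x'"
    and k: "k \<le> numDM T" and agree: "\<And>j. j < k \<Longrightarrow> snd x (\<psi> x ! j) = snd x' (\<psi> x ! j)"
  shows "take k (\<psi> x') = take k (\<psi> x)"
  using k agree
proof (induction k)
  case (Suc k)
  then show ?case by (intro causal_step(1)[OF x fst]) auto
qed simp

lemma obs_cong:
  assumes "x \<in> space (Hist T)" "x' \<in> space (Hist T)" "fst x = fst x'" "k < numDM T"
    and "\<And>j. j < k \<Longrightarrow> snd x (\<psi> x ! j) = snd x' (\<psi> x ! j)"
  shows "obs T (\<psi> x ! k) x' = obs T (\<psi> x ! k) x"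
  by (rule causal_step(2)[OF assms(1-4) take_psi_cong[OF assms(1-3) less_imp_le[OF assms(4)]]])
    (use assms(5) in auto)

section \<open>Existence and uniqueness of the closed-loop solution\<close>

text \<open>Induction on \<open>m\<close> yields a profile that solves the equations of the first
  \<open>m\<close> decision makers in the order which the profile itself induces. At
  \<open>m = numDM T\<close> these are all the equations.\<close>

lemma closed_loop_exists:
  assumes \<gamma>: "\<gamma> \<in> policies T" and \<omega>: "\<omega> \<in> space (Prob T)"
  shows "\<exists>u. closed_loop T \<gamma> \<omega> u"
proof -
  have "\<exists>u\<in>space (ActProd T). \<forall>j<m. u (\<psi> (\<omega>, u) ! j) = \<gamma> (\<psi> (\<omega>, u) ! j) (obs T (\<psi> (\<omega>, u) ! j) (\<omega>, u))"
    if "m \<le> numDM T" for m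
    using that
  proof (induction m)
    case 0
    have "space (ActProd T) \<noteq> {}"
      using Act_nonempty by (auto simp: ActProd_def space_PiM PiE_eq_empty_iff)
    then show ?case by auto
  next
    case (Suc m)
    then obtain u where u: "u \<in> space (ActProd T)"
      and IH: "\<And>j. j < m \<Longrightarrow> u (\<psi> (\<omega>, u) ! j) = \<gamma> (\<psi> (\<omega>, u) ! j) (obs T (\<psi> (\<omega>, u) ! j) (\<omega>, u))"
      by auto
    let ?x = "(\<omega>, u)"
    define i where "i = \<psi> ?x ! m"
    \<comment> \<open>The next to act now uses the action that its current measurement prescribes;
      all other actions are kept.\<close>
    define u' where "u' = u(i := \<gamma> i (obs T i ?x))"
    have x: "?x \<in> space (Hist T)" using u \<omega> by (simp add: space_Hist)
    have i: "i \<in> DMs T" using psi_nth_in_DMs[OF x] Suc by (simp add: i_def)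
    have "\<gamma> i \<in> Meas T i \<rightarrow>\<^sub>M Act T i" using \<gamma> i by (auto simp: policies_def)
    from measurable_space[OF this obs_in_space[OF x i]] have "\<gamma> i (obs T i ?x) \<in> space (Act T i)" .
    then have u': "u' \<in> space (ActProd T)"
      using u i by (auto simp: u'_def ActProd_def space_PiM PiE_iff extensional_def)
    then have x': "(\<omega>, u') \<in> space (Hist T)" using \<omega> by (simp add: space_Hist)
    have agree: "u (\<psi> ?x ! j) = u' (\<psi> ?x ! j)" if "j < m" for j
    proof -
      have "\<psi> ?x ! j \<noteq> i"
        using psi_props[OF x] that Suc.prems by (simp add: i_def nth_eq_iff_index_eq)
      then show ?thesis by (simp add: u'_def)
    qed
    \<comment> \<open>The first \<open>m\<close> actions are unchanged, so causality preserves the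
      first \<open>Suc m\<close> entries of the ordering and their measurements. Hence the earlier
      equations stay solved.\<close>
    have "take (Suc m) (\<psi> (\<omega>, u')) = take (Suc m) (\<psi> ?x)"
      using Suc.prems agree by (intro causal_step(1)[OF x x'] take_psi_cong[OF x x']) auto
    then have nth: "\<psi> (\<omega>, u') ! j = \<psi> ?x ! j" if "j < Suc m" for j
      using that by (metis nth_take)
    have obs: "obs T (\<psi> ?x ! j) (\<omega>, u') = obs T (\<psi> ?x ! j) ?x" if "j < Suc m" for j
      using Suc.prems agree that by (intro obs_cong[OF x x']) auto
    have "u' (\<psi> ?x ! j) = \<gamma> (\<psi> ?x ! j) (obs T (\<psi> ?x ! j) ?x)" if "j < Suc m" for j
    proof (cases "j < m")
      case True
      then show ?thesis using agree IH by simp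
    next
      case False
      with that have "j = m" by simp
      then show ?thesis by (simp add: u'_def i_def)
    qed
    then show ?case using u' nth obs by (intro bexI[of _ u']) auto
  qed
  then obtain u where u: "u \<in> space (ActProd T)"
    and eq: "\<And>j. j < numDM T \<Longrightarrow> u (\<psi> (\<omega>, u) ! j) = \<gamma> (\<psi> (\<omega>, u) ! j) (obs T (\<psi> (\<omega>, u) ! j) (\<omega>, u))"
    by blast
  have x: "(\<omega>, u) \<in> space (Hist T)" using u \<omega> by (simp add: space_Hist)
  have "u i = \<gamma> i (obs T i (\<omega>, u))" if "i \<in> DMs T" for i
    using eq psi_props[OF x] that by (metis in_set_conv_nth)
  then show ?thesis using u by (auto simp: closed_loop_def)
qed

text \<open>Induction along the ordering at the first solution: equal earlier actions force the same
  measurement, and the policy turns it into the same action.\<close>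

lemma closed_loop_unique:
  assumes \<omega>: "\<omega> \<in> space (Prob T)" and u: "closed_loop T \<gamma> \<omega> u" and u': "closed_loop T \<gamma> \<omega> u'"
  shows "u = u'"
proof -
  have x: "(\<omega>, u) \<in> space (Hist T)" "(\<omega>, u') \<in> space (Hist T)"
    using u u' \<omega> by (auto simp: space_Hist closed_loop_def)
  have agree: "u (\<psi> (\<omega>, u) ! k) = u' (\<psi> (\<omega>, u) ! k)" if "k < numDM T" for k
    using that
  proof (induction k rule: less_induct)
    case (less k)
    have i: "\<psi> (\<omega>, u) ! k \<in> DMs T" using psi_nth_in_DMs[OF x(1)] less.prems by simp
    have "obs T (\<psi> (\<omega>, u) ! k) (\<omega>, u') = obs T (\<psi> (\<omega>, u) ! k) (\<omega>, u)"
      using less by (intro obs_cong[OF x]) auto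
    then show ?case using u u' i by (auto simp: closed_loop_def)
  qed
  have "u i = u' i" if "i \<in> DMs T" for i
    using agree psi_props[OF x(1)] that by (metis in_set_conv_nth)
  moreover have "u \<in> extensional (DMs T)" "u' \<in> extensional (DMs T)"
    using u u' by (auto simp: closed_loop_def ActProd_def space_PiM PiE_iff)
  ultimately show ?thesis by (blast intro: extensionalityI)
qed

section \<open>Measurability of the ordering and of the measurement events\<close>

text \<open>\<open>ordering_map\<close> does not contain measurability; it is derived from
  causality, one entry of the ordering at a time.\<close>

lemma take_psi_event_measurable:
  assumes "k \<le> numDM T"
  shows "{x \<in> space (Hist T). take k (\<psi> x) = s} \<in> sets (Hist T)"
  using assms
proof (induction k arbitrary: s)
  case 0
  then show ?case by (cases "s = []") auto
next
  case (Suc k)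
  show ?case
  proof (cases "s \<in> orderings T (Suc k)")
    case False
    then have "{x \<in> space (Hist T). take (Suc k) (\<psi> x) = s} = {}"
      using take_psi_ordering Suc.prems by auto
    then show ?thesis by (simp only: sets.empty_sets)
  next
    case True
    from Suc.prems have k: "k < numDM T" by simp
    obtain A where A: "A \<in> sets (Prob T \<Otimes>\<^sub>M (\<Pi>\<^sub>M j\<in>{1..k}. ActU T))"
      and eq: "space (Hist T) \<inter> {x \<in> space (Hist T). take (Suc k) (\<psi> x) = s} = past k -` A \<inter> space (Hist T)"
      by (rule Jbar_event_past[OF k True space_in_Jbar])
    \<comment> \<open>\<open>past k\<close> reads coordinates that vary with the history. Where the
      ordering starts with \<open>take k s\<close>, it equals \<open>G\<close>, which reads fixed
      coordinates and is therefore measurable.\<close>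
    define G where "G x = (fst x, \<lambda>j\<in>{1..k}. snd x (s ! (j - 1)))" for x :: "'w \<times> (nat \<Rightarrow> 'u)"
    have "s ! (j - 1) \<in> DMs T" if "j \<in> {1..k}" for j
      using True that nth_mem[of "j - 1" s] by (auto simp: orderings_def)
    then have G: "G \<in> Hist T \<rightarrow>\<^sub>M Prob T \<Otimes>\<^sub>M (\<Pi>\<^sub>M j\<in>{1..k}. ActU T)"
      unfolding G_def by (intro measurable_Pair measurable_restrict action_measurable) (auto simp: Hist_def)
    have past: "past k x = G x" if "take k (\<psi> x) = take k s" for x
    proof -
      have "\<psi> x ! (j - 1) = s ! (j - 1)" if "j \<in> {1..k}" for j
      proof -
        from that have "j - 1 < k" by auto
        then show ?thesis using \<open>take k (\<psi> x) = take k s\<close> by (metis nth_take)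
      qed
      then show ?thesis by (auto simp: past_def G_def restrict_def ubar_def acting_def)
    qed
    have sub: "take (Suc k) (\<psi> x) = s \<Longrightarrow> take k (\<psi> x) = take k s" for x
      by (auto simp: min_def)
    have "take (Suc k) (\<psi> x) = s \<longleftrightarrow> G x \<in> A \<and> take k (\<psi> x) = take k s" if "x \<in> space (Hist T)" for x
    proof -
      have "take (Suc k) (\<psi> x) = s \<longleftrightarrow> past k x \<in> A" using eq that by blast
      with sub[of x] past[of x] show ?thesis by auto
    qed
    then have "{x \<in> space (Hist T). take (Suc k) (\<psi> x) = s}
        = (G -` A \<inter> space (Hist T)) \<inter> {x \<in> space (Hist T). take k (\<psi> x) = take k s}"
      by blast
    also have "\<dots> \<in> sets (Hist T)"
      using measurable_sets[OF G A] Suc by auto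
    finally show ?thesis .
  qed
qed

lemma psi_obs_event_measurable:
  assumes "\<And>i. i \<in> DMs T \<Longrightarrow> y i \<in> space (Meas T i)"
  shows "{x \<in> space (Hist T). \<psi> x = s \<and> (\<forall>i\<in>DMs T. obs T i x = y i)} \<in> sets (Hist T)"
proof -
  have 1: "{x \<in> space (Hist T). \<psi> x = s} = {x \<in> space (Hist T). take (numDM T) (\<psi> x) = s}"
    using psi_props(1) by auto
  have "obs T i -` {y i} \<inter> space (Hist T) \<in> sets (Hist T)" if "i \<in> DMs T" for i
    using measurable_sets[OF obs_measurable[OF that] standard_borel_singleton_in_sets[OF Meas_standard]]
      assms that by auto
  then have "{x \<in> space (Hist T). obs T i x = y i} \<in> sets (Hist T)" if "i \<in> DMs T" for i
    using that by (simp add: vimage_def Int_def conj_commute)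
  then have "{x \<in> space (Hist T). \<forall>i\<in>DMs T. obs T i x = y i} \<in> sets (Hist T)"
    by (intro sets.sets_Collect_finite_All) auto
  with take_psi_event_measurable[of "numDM T" s] 1
  show ?thesis by (intro sets.sets_Collect_conj) auto
qed

end

section \<open>Vectors of measurements and identities, and the events that produce them\<close>

locale countable_causal_team = causal_team T \<psi>
  for T :: "('w, 'a, 'b, 'n, 'u, 'y) team" and \<psi> +
  assumes Meas_countable: "\<And>i. i \<in> DMs T \<Longrightarrow> countable (space (Meas T i))"
begin

lemma MeasHat_countable:
  shows countable_MeasHat: "countable (space (MeasHat T))"
    and sets_MeasHat: "sets (MeasHat T) = Pow (space (MeasHat T))"
proof -
  have "countable (space (MeasU T))"
    unfolding MeasU_space using Meas_countable by (intro countable_UN) simp_all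
  then show c: "countable (space (MeasHat T))"
    by (simp add: MeasHat_def space_pair_measure)
  show "sets (MeasHat T) = Pow (space (MeasHat T))"
  proof (rule sets_eq_Pow_of_countable[OF c])
    fix z assume z: "z \<in> space (MeasHat T)"
    obtain a b where ab: "z = (a, b)" by (cases z)
    have "{a} \<times> {b} \<in> sets (MeasHat T)"
      unfolding MeasHat_def using z ab
      by (intro pair_measureI standard_borel_singleton_in_sets[OF MeasU_standard])
        (auto simp: MeasHat_def space_pair_measure)
    then show "{z} \<in> sets (MeasHat T)" using ab by simp
  qed
qed

abbreviation MeasProd :: "(nat \<Rightarrow> 'y \<times> nat) measure" where
  "MeasProd \<equiv> \<Pi>\<^sub>M k\<in>DMs T. MeasHat T"

lemmas MeasProd_countable =
  countable_PiM[OF finite_DMs countable_MeasHat sets_MeasHat]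

definition order_of :: "(nat \<Rightarrow> 'y \<times> nat) \<Rightarrow> nat list" where
  "order_of y = map (\<lambda>k. snd (y k)) [1..<Suc (numDM T)]"

text \<open>
  The paper's \<open>y = (y\<^sup>1, \<dots>, y\<^sup>N)\<close> of pairs (measurement, identity) need not come from any history;
  only the consistent ones below can, and the reduced cost vanishes on the others.
\<close>

definition consistent :: "(nat \<Rightarrow> 'y \<times> nat) \<Rightarrow> bool" where
  "consistent y \<longleftrightarrow> y \<in> space MeasProd \<and> order_of y \<in> orderings T (numDM T) \<and>
     (\<forall>k\<in>DMs T. fst (y k) \<in> space (Meas T (snd (y k))))"

text \<open>The turn at which decision maker \<open>i\<close> acts according to \<open>y\<close>.
  For consistent \<open>y\<close> it inverts the map from turns to identities.\<close>

definition slot :: "(nat \<Rightarrow> 'y \<times> nat) \<Rightarrow> nat \<Rightarrow> nat" where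
  "slot y i = (SOME k. k \<in> DMs T \<and> snd (y k) = i)"

definition obs_of :: "(nat \<Rightarrow> 'y \<times> nat) \<Rightarrow> nat \<Rightarrow> 'y" where
  "obs_of y i = fst (y (slot y i))"

text \<open>
  Retracting onto the action space makes \<open>profile\<close> total, so that the reduced cost is defined
  on all of the product of the \<open>ActU T\<close>.
\<close>

definition retract :: "nat \<Rightarrow> 'u \<Rightarrow> 'u" where
  "retract i a = (if a \<in> space (Act T i) then a else SOME b. b \<in> space (Act T i))"

text \<open>Here \<open>u\<close> lists actions by turn, and the result lists them by decision
  maker.\<close>

definition profile :: "(nat \<Rightarrow> 'y \<times> nat) \<Rightarrow> (nat \<Rightarrow> 'u) \<Rightarrow> nat \<Rightarrow> 'u" where
  "profile y u = (\<lambda>i\<in>DMs T. retract i (u (slot y i)))"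

text \<open>For consistent \<open>y\<close> this is the fibre of \<open>yhat\<close> over
  \<open>y\<close>, written through \<psi> and the individual measurements so that its measurability
  is at hand.\<close>

definition event :: "(nat \<Rightarrow> 'y \<times> nat) \<Rightarrow> ('w \<times> (nat \<Rightarrow> 'u)) set" where
  "event y = {x \<in> space (Hist T). \<psi> x = order_of y \<and> (\<forall>i\<in>DMs T. obs T i x = obs_of y i)}"

definition yhat :: "'w \<times> (nat \<Rightarrow> 'u) \<Rightarrow> nat \<Rightarrow> 'y \<times> nat" where
  "yhat x = (\<lambda>k\<in>DMs T. (ybar T \<psi> k x, acting \<psi> k x))"

lemma nth_order_of: "k \<in> DMs T \<Longrightarrow> order_of y ! (k - 1) = snd (y k)"
  by (auto simp: order_of_def DMs_def simp del: upt_Suc)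

lemma set_order_of: "set (order_of y) = (\<lambda>k. snd (y k)) ` DMs T"
  by (auto simp: order_of_def DMs_def)

lemma slot_props:
  assumes "consistent y" "i \<in> DMs T"
  shows "slot y i \<in> DMs T" "snd (y (slot y i)) = i"
proof -
  have "i \<in> set (order_of y)"
    using assms full_ordering(3)[of "order_of y"] by (simp add: consistent_def)
  then have "\<exists>k. k \<in> DMs T \<and> snd (y k) = i"
    by (auto simp: set_order_of)
  from someI_ex[OF this] show "slot y i \<in> DMs T" "snd (y (slot y i)) = i" by (auto simp: slot_def)
qed

lemma snd_consistent: "consistent y \<Longrightarrow> k \<in> DMs T \<Longrightarrow> snd (y k) \<in> DMs T"
  using full_ordering(3)[of "order_of y"] by (auto simp: consistent_def set_order_of)

text \<open>The entries of \<open>order_of y\<close> are distinct, so an identity occurs at one turn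
  only. Turn \<open>k\<close> sits at list position \<open>k - 1\<close>.\<close>

lemma slot_snd:
  assumes y: "consistent y" and k: "k \<in> DMs T"
  shows "slot y (snd (y k)) = k"
proof -
  have i: "snd (y k) \<in> DMs T" by (rule snd_consistent[OF y k])
  have "order_of y ! (slot y (snd (y k)) - 1) = order_of y ! (k - 1)"
    using slot_props[OF y i] nth_order_of[OF k, of y] nth_order_of[of "slot y (snd (y k))" y] by simp
  moreover have "slot y (snd (y k)) - 1 < numDM T" "k - 1 < numDM T"
    using slot_props(1)[OF y i] k by (auto simp: DMs_def)
  ultimately have "slot y (snd (y k)) - 1 = k - 1"
    using y full_ordering[of "order_of y"] by (simp add: consistent_def nth_eq_iff_index_eq)
  then show ?thesis using slot_props(1)[OF y i] k by (auto simp: DMs_def)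
qed

lemma obs_of_in_space: "consistent y \<Longrightarrow> i \<in> DMs T \<Longrightarrow> obs_of y i \<in> space (Meas T i)"
  using slot_props[of y i] by (auto simp: consistent_def obs_of_def)

lemma component_eq: "consistent y \<Longrightarrow> i \<in> DMs T \<Longrightarrow> y (slot y i) = (obs_of y i, i)"
  using slot_props(2)[of y i] by (simp add: obs_of_def prod_eq_iff)

lemma event_measurable: "consistent y \<Longrightarrow> event y \<in> sets (Hist T)"
  unfolding event_def by (rule psi_obs_event_measurable) (rule obs_of_in_space)

lemma acting_in_DMs: "x \<in> space (Hist T) \<Longrightarrow> k \<in> DMs T \<Longrightarrow> acting \<psi> k x \<in> DMs T"
  unfolding acting_def by (rule psi_nth_in_DMs) (auto simp: DMs_def)

lemma order_of_yhat:
  assumes "x \<in> space (Hist T)"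
  shows "order_of (yhat x) = \<psi> x"
proof (rule nth_equalityI)
  show "length (order_of (yhat x)) = length (\<psi> x)"
    using psi_props[OF assms] by (simp add: order_of_def del: upt_Suc)
  fix j assume "j < length (order_of (yhat x))"
  then have "Suc j \<in> DMs T" by (auto simp: order_of_def DMs_def simp del: upt_Suc)
  with nth_order_of[OF this, of "yhat x"] show "order_of (yhat x) ! j = \<psi> x ! j"
    by (simp add: yhat_def acting_def)
qed

lemma consistent_yhat:
  assumes x: "x \<in> space (Hist T)"
  shows "consistent (yhat x)"
  unfolding consistent_def
proof (intro conjI ballI)
  have obs: "ybar T \<psi> k x \<in> space (Meas T (acting \<psi> k x))" if "k \<in> DMs T" for k
    unfolding ybar_def by (rule obs_in_space[OF x acting_in_DMs[OF x that]])
  then show "fst (yhat x k) \<in> space (Meas T (snd (yhat x k)))" if "k \<in> DMs T" for k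
    using that by (simp add: yhat_def)
  show "yhat x \<in> space MeasProd"
    using obs acting_in_DMs[OF x]
    by (auto simp: yhat_def space_PiM MeasHat_def space_pair_measure MeasU_space)
  show "order_of (yhat x) \<in> orderings T (numDM T)"
    using psi_ordering[OF x] order_of_yhat[OF x] by simp
qed

text \<open>A consistent \<open>y\<close> can be rebuilt from its ordering and its measurements by
  decision maker. Together with \<open>consistent_yhat\<close>, this makes the events of consistent
  vectors a partition of the histories.\<close>

lemma in_event_iff:
  assumes y: "consistent y" and x: "x \<in> space (Hist T)"
  shows "x \<in> event y \<longleftrightarrow> y = yhat x"
proof
  assume ev: "x \<in> event y"
  show "y = yhat x"
  proof (rule extensionalityI)
    show "y \<in> extensional (DMs T)" "yhat x \<in> extensional (DMs T)"
      using y by (auto simp: consistent_def space_PiM PiE_iff yhat_def)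
    fix k assume k: "k \<in> DMs T"
    have snd: "snd (y k) = acting \<psi> k x"
      using nth_order_of[OF k, of y] ev by (simp add: event_def acting_def)
    have "fst (y k) = obs_of y (snd (y k))"
      by (simp add: obs_of_def slot_snd[OF y k])
    also have "\<dots> = ybar T \<psi> k x"
      using ev acting_in_DMs[OF x k] by (simp add: event_def ybar_def snd)
    finally show "y k = yhat x k"
      using k snd by (simp add: yhat_def prod_eq_iff)
  qed
next
  assume eq: "y = yhat x"
  have "obs T i x = obs_of y i" if "i \<in> DMs T" for i
    using slot_props[OF y that] by (auto simp: obs_of_def eq yhat_def ybar_def)
  then show "x \<in> event y"
    using x order_of_yhat[OF x] by (simp add: event_def eq)
qed

section \<open>Action profiles determined by a measurement vector\<close>

lemma retract_measurable:
  assumes i: "i \<in> DMs T"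
  shows "retract i \<in> ActU T \<rightarrow>\<^sub>M Act T i"
proof -
  have default: "(SOME b. b \<in> space (Act T i)) \<in> space (Act T i)"
    using Act_nonempty[OF i] by (auto intro: someI_ex)
  have "retract i \<in> ActU T \<rightarrow>\<^sub>M restrict_space (ActU T) (space (Act T i))"
  proof (rule measurable_restrict_space2)
    show "retract i \<in> space (ActU T) \<rightarrow> space (Act T i)"
      using default by (auto simp: retract_def)
    show "retract i \<in> ActU T \<rightarrow>\<^sub>M ActU T"
      unfolding retract_def
    proof (rule measurable_If_set)
      show "(\<lambda>_. SOME b. b \<in> space (Act T i)) \<in> ActU T \<rightarrow>\<^sub>M ActU T"
        using default i by (intro measurable_const) (auto simp: ActU_space)
    qed (use Act_in_ActU[OF i] in auto)
  qed
  then show ?thesis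
    by (subst measurable_cong_sets[OF refl Act_subspace[OF i]])
qed

lemma profile_measurable:
  assumes "consistent y"
  shows "profile y \<in> (\<Pi>\<^sub>M k\<in>DMs T. ActU T) \<rightarrow>\<^sub>M ActProd T"
  unfolding profile_def ActProd_def
  by (rule measurable_restrict,
      rule measurable_compose[OF measurable_component_singleton[OF slot_props(1)[OF assms]] retract_measurable])

lemma policy_action_in_space:
  assumes \<gamma>: "\<gamma> \<in> policies T" and y: "consistent y" and i: "i \<in> DMs T"
  shows "\<gamma> i (obs_of y i) \<in> space (Act T i)"
proof -
  have "\<gamma> i \<in> Meas T i \<rightarrow>\<^sub>M Act T i" using \<gamma> i by (simp add: policies_def)
  then show ?thesis by (rule measurable_space) (rule obs_of_in_space[OF y i])
qed

text \<open>At a consistent \<open>y\<close> every extension is evaluated only where it must agree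
  with \<gamma>, and the retraction fixes admissible actions. The result is thus the same for all
  extensions.\<close>

lemma profile_policy:
  assumes \<gamma>: "\<gamma> \<in> policies T" and im: "imaginary_policy T \<gamma> \<gamma>'" and y: "consistent y"
  shows "profile y (\<lambda>k\<in>DMs T. \<gamma>' k (y k)) = (\<lambda>i\<in>DMs T. \<gamma> i (obs_of y i))"
proof -
  have "retract i (\<gamma>' (slot y i) (y (slot y i))) = \<gamma> i (obs_of y i)" if i: "i \<in> DMs T" for i
  proof -
    have "\<gamma>' (slot y i) (y (slot y i)) = \<gamma> i (obs_of y i)"
      using im slot_props(1)[OF y i] i obs_of_in_space[OF y i] component_eq[OF y i]
      by (simp add: imaginary_policy_def)
    then show ?thesis
      using policy_action_in_space[OF \<gamma> y i] by (simp add: retract_def)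
  qed
  then show ?thesis
    unfolding profile_def by (intro restrict_ext) (simp add: slot_props(1)[OF y])
qed

lemma policy_profile_in_space:
  assumes "\<gamma> \<in> policies T" and "consistent y"
  shows "(\<lambda>i\<in>DMs T. \<gamma> i (obs_of y i)) \<in> space (ActProd T)"
  using policy_action_in_space[OF assms] by (simp add: ActProd_def space_PiM)

text \<open>The profile \<open>v\<close> is computed from \<open>y\<close> without feedback. If
  \<open>(\<omega>, v)\<close> produces the measurements in \<open>y\<close>, then \<open>v\<close>
  solves the closed loop and uniqueness gives \<open>v = u\<close>; conversely, at
  \<open>y = yhat (\<omega>, u)\<close> the closed-loop equations for \<open>u\<close> read
  \<open>u = v\<close>.\<close>

lemma open_loop_event_iff:
  assumes \<gamma>: "\<gamma> \<in> policies T" and y: "consistent y" and \<omega>: "\<omega> \<in> space (Prob T)"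
    and u: "closed_loop T \<gamma> \<omega> u"
  defines "v \<equiv> \<lambda>i\<in>DMs T. \<gamma> i (obs_of y i)"
  shows "(\<omega>, v) \<in> event y \<longleftrightarrow> y = yhat (\<omega>, u)" and "y = yhat (\<omega>, u) \<Longrightarrow> v = u"
proof -
  have v: "v \<in> space (ActProd T)"
    unfolding v_def by (rule policy_profile_in_space[OF \<gamma> y])
  then have xv: "(\<omega>, v) \<in> space (Hist T)" using \<omega> by (simp add: space_Hist)
  have xu: "(\<omega>, u) \<in> space (Hist T)" using \<omega> u by (simp add: space_Hist closed_loop_def)
  have vu: "v = u" if "y = yhat (\<omega>, u)"
  proof (rule extensionalityI)
    show "v \<in> extensional (DMs T)" "u \<in> extensional (DMs T)"
      using u by (auto simp: v_def closed_loop_def ActProd_def space_PiM PiE_iff)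
    have "(\<omega>, u) \<in> event y" using in_event_iff[OF y xu] that by simp
    then show "v i = u i" if "i \<in> DMs T" for i
      using that u by (auto simp: v_def event_def closed_loop_def)
  qed
  then show "y = yhat (\<omega>, u) \<Longrightarrow> v = u" .
  show "(\<omega>, v) \<in> event y \<longleftrightarrow> y = yhat (\<omega>, u)"
  proof
    assume ev: "(\<omega>, v) \<in> event y"
    then have "closed_loop T \<gamma> \<omega> v"
      using v by (auto simp: closed_loop_def event_def v_def)
    from closed_loop_unique[OF \<omega> this u] have "v = u" .
    then show "y = yhat (\<omega>, u)" using in_event_iff[OF y xv] ev by simp
  next
    assume eq: "y = yhat (\<omega>, u)"
    then show "(\<omega>, v) \<in> event y"
      using in_event_iff[OF y xu] vu[OF eq] by simp
  qed
qed

text \<open>The only term that can be nonzero is the one at \<open>yhat (\<omega>, u)\<close> for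
  the solution \<open>u\<close>, where \<open>v y = u\<close>.\<close>

lemma closed_loop_cost_eq_sum:
  assumes \<gamma>: "\<gamma> \<in> policies T" and \<omega>: "\<omega> \<in> space (Prob T)"
  defines "v \<equiv> \<lambda>y. \<lambda>i\<in>DMs T. \<gamma> i (obs_of y i)"
  shows "ennreal (c (THE u. closed_loop T \<gamma> \<omega> u))
    = (\<integral>\<^sup>+y. (if consistent y then ennreal (c (v y)) * indicator (event y) (\<omega>, v y) else 0)
         \<partial>count_space (space MeasProd))"
proof -
  obtain u where u: "closed_loop T \<gamma> \<omega> u" using closed_loop_exists[OF \<gamma> \<omega>] by blast
  then have the: "(THE u. closed_loop T \<gamma> \<omega> u) = u"
    using closed_loop_unique[OF \<omega>] by blast
  have x: "(\<omega>, u) \<in> space (Hist T)" using \<omega> u by (simp add: space_Hist closed_loop_def)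
  note cons = consistent_yhat[OF x]
  then have mem: "yhat (\<omega>, u) \<in> space MeasProd" by (simp add: consistent_def)
  have "(if consistent y then ennreal (c (v y)) * indicator (event y) (\<omega>, v y) else 0)
      = ennreal (c u) * indicator {yhat (\<omega>, u)} y" for y
    using open_loop_event_iff[OF \<gamma> _ \<omega> u, of y] cons
    by (auto simp: v_def indicator_def)
  then have "(\<integral>\<^sup>+y. (if consistent y then ennreal (c (v y)) * indicator (event y) (\<omega>, v y) else 0)
         \<partial>count_space (space MeasProd))
      = (\<integral>\<^sup>+y. ennreal (c u) * indicator {yhat (\<omega>, u)} y \<partial>count_space (space MeasProd))"
    by simp
  also have "\<dots> = ennreal (c u)"
    using mem by (subst nn_integral_cmult_indicator) auto
  finally show ?thesis by (simp add: the)
qed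

lemma MeasHat_nonempty:
  assumes "DMs T \<noteq> {}"
  shows "space (MeasHat T) \<noteq> {}"
proof -
  obtain \<omega> where \<omega>: "\<omega> \<in> space (Prob T)" using not_empty by blast
  have "space (ActProd T) \<noteq> {}"
    using Act_nonempty by (auto simp: ActProd_def space_PiM PiE_eq_empty_iff)
  then obtain u where "u \<in> space (ActProd T)" by blast
  with \<omega> have x: "(\<omega>, u) \<in> space (Hist T)" by (simp add: space_Hist)
  from assms obtain i where i: "i \<in> DMs T" by blast
  then have "(obs T i (\<omega>, u), i) \<in> space (MeasHat T)"
    using obs_in_space[OF x i] by (auto simp: MeasHat_def space_pair_measure MeasU_space)
  then show ?thesis by blast
qed

lemma cost_section_measurable:
  assumes "v \<in> space (ActProd T)"
  shows "(\<lambda>x. ennreal (cost T (fst x, snd x, v))) \<in> borel_measurable (CostSp T \<Otimes>\<^sub>M OrdSp T)"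
proof -
  have "(\<lambda>x. (fst x, snd x, v)) \<in> CostSp T \<Otimes>\<^sub>M OrdSp T \<rightarrow>\<^sub>M CostSp T \<Otimes>\<^sub>M OrdSp T \<Otimes>\<^sub>M ActProd T"
    using assms by (intro measurable_Pair measurable_fst measurable_snd measurable_const)
  from measurable_compose[OF this cost_measurable] show ?thesis by measurable
qed

section \<open>Construction and verification of the static reduction\<close>

lemma static_reduction: "policy_independent_static_reduction T"
proof -
  define M where "M = CostSp T \<Otimes>\<^sub>M OrdSp T"
  define X where "X \<omega> = (cost_rv T \<omega>, ord_rv T \<omega>)" for \<omega>
  have X: "X \<in> Prob T \<rightarrow>\<^sub>M M"
    unfolding X_def M_def by (intro measurable_Pair cost_rv_measurable ord_rv_measurable)
  \<comment> \<open>One measure serves all turns, since every pair lives in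
    \<open>MeasHat T\<close>. Without decision makers that space is empty and carries no probability
    measure, which explains the premises; the empty product \<open>QP\<close> is still a probability
    space.\<close>
  obtain Q :: "('y \<times> nat) measure" where Q: "DMs T \<noteq> {} \<Longrightarrow> prob_space Q"
    and sets_Q: "DMs T \<noteq> {} \<Longrightarrow> sets Q = sets (MeasHat T)"
    and Q_pos: "\<And>z. DMs T \<noteq> {} \<Longrightarrow> z \<in> space (MeasHat T) \<Longrightarrow> 0 < emeasure Q {z}"
  proof (cases "DMs T = {}")
    case False
    from full_support_prob_space[OF countable_MeasHat MeasHat_nonempty[OF this]]
    show thesis using that sets_MeasHat by metis
  qed (use that in auto)
  define QP where "QP = (\<Pi>\<^sub>M k\<in>DMs T. Q)"
  have sets_QP: "sets QP = sets MeasProd"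
    unfolding QP_def by (rule sets_PiM_cong) (use sets_Q in auto)
  then have space_QP: "space QP = space MeasProd" by (rule sets_eq_imp_space_eq)
  interpret QP: prob_space QP
    unfolding QP_def by (rule prob_space_PiM) (use Q in auto)
  have QP_pos: "0 < emeasure QP {y}" if "y \<in> space MeasProd" for y
    unfolding QP_def
  proof (rule PiM_singleton_pos)
    fix i z assume "i \<in> DMs T" and z: "z \<in> space Q"
    then have ne: "DMs T \<noteq> {}" by blast
    have "z \<in> space (MeasHat T)" using z sets_eq_imp_space_eq[OF sets_Q[OF ne]] by simp
    then show "{z} \<in> sets Q \<and> 0 < emeasure Q {z}"
      using Q_pos[OF ne] sets_Q[OF ne] sets_MeasHat by auto
  qed (use Q that space_QP QP_def in auto)
  define kernel where "kernel y g \<longleftrightarrow> g \<in> borel_measurable (M \<Otimes>\<^sub>M ActProd T) \<and> (\<forall>z. g z \<le> 1) \<and>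
      (\<forall>v f. v \<in> space (ActProd T) \<longrightarrow> f \<in> borel_measurable M \<longrightarrow>
        (\<integral>\<^sup>+\<omega>. f (X \<omega>) * indicator (event y) (\<omega>, v) \<partial>Prob T)
          = (\<integral>\<^sup>+x. f x * g (x, v) \<partial>distr (Prob T) M X))"
    for y and g :: "('a \<times> 'b) \<times> (nat \<Rightarrow> 'u) \<Rightarrow> ennreal"
  have "\<exists>g. kernel y g" if "consistent y" for y
    unfolding kernel_def
    by (rule parametric_conditional_probability[OF prob_space_axioms X
          event_measurable[OF that, unfolded Hist_def]]) blast
  then have "\<forall>y. \<exists>g. consistent y \<longrightarrow> kernel y g" by blast
  from choice[OF this] obtain g where g: "\<And>y. consistent y \<Longrightarrow> kernel y (g y)" by blast
  have g_meas: "g y \<in> borel_measurable (M \<Otimes>\<^sub>M ActProd T)" and g_le: "g y z \<le> 1" if "consistent y" for y z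
    using g[OF that] unfolding kernel_def by blast+
  have g_int: "(\<integral>\<^sup>+\<omega>. f (X \<omega>) * indicator (event y) (\<omega>, v) \<partial>Prob T)
          = (\<integral>\<^sup>+x. f x * g y (x, v) \<partial>distr (Prob T) M X)"
    if "consistent y" "v \<in> space (ActProd T)" "f \<in> borel_measurable M" for y v f
    using g[OF that(1)] that(2,3) by (simp add: kernel_def)
  \<comment> \<open>The division compensates for the weight that \<open>QP\<close> gives to
    \<open>y\<close>. Since \<open>g y\<close> is at most 1, \<open>enn2real\<close> loses
    nothing.\<close>
  define h where "h y a b u =
      (if consistent y
       then cost T (a, b, profile y u) * enn2real (g y ((a, b), profile y u)) / measure QP {y} else 0)"
    for y a b u
  define C where "C = (\<lambda>(a, b, y, u). h y a b u)"
  let ?U = "\<Pi>\<^sub>M k\<in>DMs T. ActU T"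
  have h_meas: "(\<lambda>(a, b, y', u). h y a b u) \<in> borel_measurable (CostSp T \<Otimes>\<^sub>M OrdSp T \<Otimes>\<^sub>M MeasProd \<Otimes>\<^sub>M ?U)"
    for y
  proof (cases "consistent y")
    case True
    note [measurable] = profile_measurable[OF True] g_meas[OF True, unfolded M_def] cost_measurable
    show ?thesis unfolding h_def using True by simp
  qed (simp add: h_def)
  \<comment> \<open>\<open>MeasProd\<close> is countable and discrete, so measurability of each
    \<open>h y\<close> suffices for joint measurability of \<open>C\<close>.\<close>
  have idx: "(\<lambda>x. fst (snd (snd x))) \<in> CostSp T \<Otimes>\<^sub>M OrdSp T \<Otimes>\<^sub>M MeasProd \<Otimes>\<^sub>M ?U \<rightarrow>\<^sub>M count_space (space MeasProd)"
    by (subst measurable_cong_sets[OF refl, of _ MeasProd])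
      (simp_all add: MeasProd_countable(2))
  have C_meas: "C \<in> borel_measurable (CostSp T \<Otimes>\<^sub>M OrdSp T \<Otimes>\<^sub>M MeasProd \<Otimes>\<^sub>M ?U)"
    using measurable_compose_countable'[OF h_meas idx MeasProd_countable(1)]
    by (simp add: C_def case_prod_unfold)
  have C_nonneg: "0 \<le> C x"
    if x: "x \<in> space (CostSp T \<Otimes>\<^sub>M OrdSp T \<Otimes>\<^sub>M MeasProd \<Otimes>\<^sub>M ?U)" for x
  proof -
    obtain a b y u where eq: "x = (a, b, y, u)" by (cases x) auto
    have sp: "a \<in> space (CostSp T)" "b \<in> space (OrdSp T)" "u \<in> space ?U"
      using x by (auto simp: eq space_pair_measure)
    show ?thesis
    proof (cases "consistent y")
      case True
      then have "(a, b, profile y u) \<in> space (CostSp T \<Otimes>\<^sub>M OrdSp T \<Otimes>\<^sub>M ActProd T)"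
        using sp measurable_space[OF profile_measurable[OF True] sp(3)] by (simp add: space_pair_measure)
      then show ?thesis by (simp add: eq C_def h_def cost_nonneg)
    qed (simp add: eq C_def h_def)
  qed
  have "J T \<gamma> = static_cost T (\<lambda>_. Q) C \<gamma>'"
    if \<gamma>: "\<gamma> \<in> policies T" and im: "imaginary_policy T \<gamma> \<gamma>'" for \<gamma> \<gamma>'
  proof -
    define v where "v y = (\<lambda>i\<in>DMs T. \<gamma> i (obs_of y i))" for y
    have v_space: "v y \<in> space (ActProd T)" if "consistent y" for y
      unfolding v_def by (rule policy_profile_in_space[OF \<gamma> that])
    have cost_meas: "(\<lambda>x. ennreal (cost T (fst x, snd x, v y))) \<in> borel_measurable M" if "consistent y" for y
      unfolding M_def by (rule cost_section_measurable[OF v_space[OF that]])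
    define D where "D = distr (Prob T) M X"
    have [simp]: "space D = space M" "sets D = sets M" by (simp_all add: D_def)
    \<comment> \<open>The product of Dirac laws is a Dirac law at \<open>w\<close>, whose profile is
      \<open>v y\<close>, and the mass of \<open>y\<close> cancels the denominator. For inconsistent
      \<open>y\<close> both sides are 0.\<close>
    have inner: "(\<integral>\<^sup>+u. ennreal (C (a, b, y, u)) \<partial>(\<Pi>\<^sub>M k\<in>DMs T. return (ActU T) (\<gamma>' k (y k)))) * emeasure QP {y}
        = (if consistent y then ennreal (cost T (a, b, v y)) * g y ((a, b), v y) else 0)"
      if a: "a \<in> space (CostSp T)" and b: "b \<in> space (OrdSp T)" and y: "y \<in> space MeasProd" for a b y
    proof -
      have act: "\<gamma>' k (y k) \<in> space (ActU T)" if "k \<in> DMs T" for k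
      proof -
        have "\<gamma>' k \<in> MeasHat T \<rightarrow>\<^sub>M ActU T" using im that by (simp add: imaginary_policy_def)
        then show ?thesis using y that by (auto simp: space_PiM intro: measurable_space)
      qed
      define w where "w = (\<lambda>k\<in>DMs T. \<gamma>' k (y k))"
      have w: "w \<in> space ?U" using act by (simp add: w_def space_PiM)
      have ret: "(\<Pi>\<^sub>M k\<in>DMs T. return (ActU T) (\<gamma>' k (y k))) = return ?U w"
        unfolding w_def
        by (rule PiM_return[OF finite_DMs]) (rule standard_borel_singleton_in_sets[OF ActU_standard act])
      have "(\<lambda>u. (a, b, y, u)) \<in> ?U \<rightarrow>\<^sub>M CostSp T \<Otimes>\<^sub>M OrdSp T \<Otimes>\<^sub>M MeasProd \<Otimes>\<^sub>M ?U"
        using a b y by (intro measurable_Pair measurable_const measurable_ident_sets[OF refl])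
      from measurable_compose[OF this C_meas]
      have "(\<lambda>u. ennreal (C (a, b, y, u))) \<in> borel_measurable ?U" by measurable
      then have "(\<integral>\<^sup>+u. ennreal (C (a, b, y, u)) \<partial>(\<Pi>\<^sub>M k\<in>DMs T. return (ActU T) (\<gamma>' k (y k)))) = ennreal (C (a, b, y, w))"
        unfolding ret by (rule nn_integral_return[OF w])
      moreover have "ennreal (C (a, b, y, w)) * emeasure QP {y}
          = ennreal (cost T (a, b, v y)) * g y ((a, b), v y)" if cons: "consistent y"
      proof -
        have prof: "profile y w = v y"
          unfolding w_def v_def by (rule profile_policy[OF \<gamma> im cons])
        have "0 \<le> cost T (a, b, v y)"
          using v_space[OF cons] a b by (intro cost_nonneg) (simp add: space_pair_measure)
        moreover have "0 < measure QP {y}"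
          using QP_pos[OF y] by (simp add: QP.emeasure_eq_measure)
        moreover have "ennreal (enn2real (g y ((a, b), v y))) = g y ((a, b), v y)"
          using g_le[OF cons, of "((a, b), v y)"] by (intro ennreal_enn2real) (auto simp: less_top[symmetric] top_unique)
        moreover have "ennreal (C (a, b, y, w)) * emeasure QP {y}
            = ennreal (cost T (a, b, v y) * enn2real (g y ((a, b), v y)) / measure QP {y} * measure QP {y})"
          using cons by (simp add: C_def h_def prof QP.emeasure_eq_measure ennreal_mult''[symmetric])
        ultimately show ?thesis by (simp add: ennreal_mult)
      qed
      ultimately show ?thesis by (simp add: C_def h_def)
    qed
    have "J T \<gamma> = (\<integral>\<^sup>+\<omega>. (\<integral>\<^sup>+y. (if consistent y
        then ennreal (cost T (fst (X \<omega>), snd (X \<omega>), v y)) * indicator (event y) (\<omega>, v y) else 0)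
        \<partial>count_space (space MeasProd)) \<partial>Prob T)"
      unfolding J_def
    proof (rule nn_integral_cong)
      fix \<omega> assume "\<omega> \<in> space (Prob T)"
      from closed_loop_cost_eq_sum[OF \<gamma> this, of "\<lambda>u. cost T (cost_rv T \<omega>, ord_rv T \<omega>, u)"]
      show "ennreal (cost T (cost_rv T \<omega>, ord_rv T \<omega>, THE u. closed_loop T \<gamma> \<omega> u))
        = (\<integral>\<^sup>+y. (if consistent y
            then ennreal (cost T (fst (X \<omega>), snd (X \<omega>), v y)) * indicator (event y) (\<omega>, v y) else 0)
            \<partial>count_space (space MeasProd))"
        unfolding X_def v_def fst_conv snd_conv .
    qed
    also have "\<dots> = (\<integral>\<^sup>+y. (\<integral>\<^sup>+\<omega>. (if consistent y
        then ennreal (cost T (fst (X \<omega>), snd (X \<omega>), v y)) * indicator (event y) (\<omega>, v y) else 0)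
        \<partial>Prob T) \<partial>count_space (space MeasProd))"
    proof (rule nn_integral_count_space_nn_integral)
      fix y
      show "(\<lambda>\<omega>. if consistent y
          then ennreal (cost T (fst (X \<omega>), snd (X \<omega>), v y)) * indicator (event y) (\<omega>, v y) else 0)
          \<in> borel_measurable (Prob T)"
      proof (cases "consistent y")
        case True
        have "(\<lambda>\<omega>. ennreal (cost T (fst (X \<omega>), snd (X \<omega>), v y))) \<in> borel_measurable (Prob T)"
          by (rule measurable_compose[OF X cost_meas[OF True]])
        moreover have "(\<lambda>\<omega>. indicator (event y) (\<omega>, v y) :: ennreal) \<in> borel_measurable (Prob T)"
          by (rule measurable_compose[OF measurable_Pair2'[OF v_space[OF True]]
                borel_measurable_indicator[OF event_measurable[OF True, unfolded Hist_def]]])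
        ultimately show ?thesis using True by simp
      qed simp
    qed (rule MeasProd_countable(1))
    \<comment> \<open>With the sum now outside, \<open>v y\<close> is a constant profile, so
      \<open>g_int\<close> applies with the cost section as \<open>f\<close>.\<close>
    also have "\<dots> = (\<integral>\<^sup>+y. (\<integral>\<^sup>+x. (if consistent y
        then ennreal (cost T (fst x, snd x, v y)) * g y (x, v y) else 0) \<partial>D) \<partial>count_space (space MeasProd))"
    proof (rule nn_integral_cong)
      fix y
      show "(\<integral>\<^sup>+\<omega>. (if consistent y
          then ennreal (cost T (fst (X \<omega>), snd (X \<omega>), v y)) * indicator (event y) (\<omega>, v y) else 0) \<partial>Prob T)
        = (\<integral>\<^sup>+x. (if consistent y
          then ennreal (cost T (fst x, snd x, v y)) * g y (x, v y) else 0) \<partial>D)"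
        using g_int[OF _ v_space cost_meas, of y] by (cases "consistent y") (simp_all add: D_def)
    qed
    also have "\<dots> = (\<integral>\<^sup>+x. (\<integral>\<^sup>+y. (if consistent y
        then ennreal (cost T (fst x, snd x, v y)) * g y (x, v y) else 0) \<partial>count_space (space MeasProd)) \<partial>D)"
    proof (rule nn_integral_count_space_nn_integral[symmetric])
      fix y
      show "(\<lambda>x. if consistent y then ennreal (cost T (fst x, snd x, v y)) * g y (x, v y) else 0)
          \<in> borel_measurable D"
      proof (cases "consistent y")
        case True
        have "(\<lambda>x. g y (x, v y)) \<in> borel_measurable M"
          by (rule measurable_compose[OF measurable_Pair2'[OF v_space[OF True]] g_meas[OF True]])
        then have "(\<lambda>x. g y (x, v y)) \<in> borel_measurable D"
            "(\<lambda>x. ennreal (cost T (fst x, snd x, v y))) \<in> borel_measurable D"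
          using cost_meas[OF True] by (simp_all add: D_def)
        then show ?thesis using True by simp
      qed simp
    qed (rule MeasProd_countable(1))
    also have "\<dots> = static_cost T (\<lambda>_. Q) C \<gamma>'"
      unfolding static_cost_def QP_def[symmetric] M_def[symmetric] X_def[symmetric]
    proof (fold D_def, rule nn_integral_cong)
      fix x assume "x \<in> space D"
      then have x: "fst x \<in> space (CostSp T)" "snd x \<in> space (OrdSp T)"
        by (auto simp: M_def space_pair_measure)
      \<comment> \<open>On the countable discrete space the integral against \<open>QP\<close> is a
        sum weighted by point masses, and \<open>inner\<close> evaluates each term.\<close>
      have "(\<integral>\<^sup>+y. (\<integral>\<^sup>+u. ennreal (C (fst x, snd x, y, u)) \<partial>(\<Pi>\<^sub>M k\<in>DMs T. return (ActU T) (\<gamma>' k (y k)))) \<partial>QP)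
        = (\<integral>\<^sup>+y. (\<integral>\<^sup>+u. ennreal (C (fst x, snd x, y, u)) \<partial>(\<Pi>\<^sub>M k\<in>DMs T. return (ActU T) (\<gamma>' k (y k))))
            * emeasure QP {y} \<partial>count_space (space QP))"
        by (rule nn_integral_countable_space) (simp_all add: space_QP sets_QP MeasProd_countable)
      also have "\<dots> = (\<integral>\<^sup>+y. (if consistent y
          then ennreal (cost T (fst x, snd x, v y)) * g y (x, v y) else 0) \<partial>count_space (space MeasProd))"
        unfolding space_QP by (rule nn_integral_cong) (use inner[OF x, unfolded prod.collapse] in simp)
      finally show "(\<integral>\<^sup>+y. (if consistent y
          then ennreal (cost T (fst x, snd x, v y)) * g y (x, v y) else 0) \<partial>count_space (space MeasProd))
        = (\<integral>\<^sup>+y. (\<integral>\<^sup>+u. ennreal (C (fst x, snd x, y, u)) \<partial>(\<Pi>\<^sub>M k\<in>DMs T. return (ActU T) (\<gamma>' k (y k)))) \<partial>QP)"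
        by simp
    qed
    finally show ?thesis .
  qed
  moreover have "\<forall>k\<in>DMs T. prob_space Q \<and> sets Q = sets (MeasHat T)" using Q sets_Q by auto
  ultimately show ?thesis
    unfolding policy_independent_static_reduction_def Let_def
    by (intro exI[of _ "\<lambda>_. Q"] exI[of _ C] conjI ballI allI impI C_meas C_nonneg) auto
qed

end

theorem theorem3p1:
  fixes T :: "('w, 'a, 'b, 'n, 'u, 'y) team"
  assumes "nonsequential_team T"
    and "property_C T"
    and "\<And>i. i \<in> DMs T \<Longrightarrow> countable (space (Meas T i))"
  shows "policy_independent_static_reduction T"
proof -
  interpret nonsequential_team T by fact
  from assms(2) obtain \<psi> where \<psi>: "ordering_map T \<psi>"
    and causal: "\<forall>k\<in>{1..numDM T}. \<forall>s\<in>orderings T k.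
        {E \<inter> {x \<in> space (Hist T). take k (\<psi> x) = s} | E. E \<in> sets (Jbar T \<psi> k)}
          \<subseteq> sets (Fstar T \<psi> (k - 1))"
    unfolding property_C_def by (elim exE conjE) (rule that)
  interpret countable_causal_team T \<psi>
    by unfold_locales (rule \<psi>, rule causal[THEN bspec, THEN bspec], assumption+, rule assms(3))
  show ?thesis by (rule static_reduction)
qed

end
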